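(* Let $(M,g)$ be a Riemannian or pseudo-Riemannian manifold, and let $\mathcal G_g$ be the generalized metric on $\mathbb TM=TM\oplus T^*M$ induced by $g$. Then the generalized almost complex structure $\mathcal J_g$ and the generalized almost paracomplex structure $\mathcal F_g$ given by $$\mathcal J_g=\begin{pmatrix}0&-\sharp_g\\ \flat_g&0\end{pmatrix},\qquad \mathcal F_g=\begin{pmatrix}0&\sharp_g\\ \flat_g&0\end{pmatrix}$$ are isometric with respect to $\mathcal G_g$. In other words, $(\mathcal J_g,\mathcal G_g)$ is a generalized almost Hermitian or indefinite almost Hermitian structure (depending on whether $g$ is Riemannian or pseudo-Riemannian) and $(\mathcal F_g,\mathcal G_g)$ is a generalized almost para-Norden or pseudo-Riemannian almost product structure (depending on whether $g$ is Riemannian or pseudo-Riemannian). Their respective fundamental tensors are $$\Phi_{\mathcal J_g}(X+\xi,Y+\eta)=-2\Omega_0(X+\xi,Y+\eta),\qquad \Phi_{\mathcal F_g}(X+\xi,Y+\eta)=2\mathcal G_0(X+\xi,Y+\eta)$$ for all $X,Y\in\mathfrak X(M)$, $\xi,\eta\in\Lambda^1(M)$.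
   Context: A metric is Riemannian if positive definite and pseudo-Riemannian if (nondegenerate and) not positive definite. $\mathfrak F(M)$, $\mathfrak X(M)$, $\Lambda^1(M)$ denote smooth functions, vector fields, 1-forms; sections of $\mathbb TM$ are written $X+\xi$. $(\flat_gX)(Y)=g(X,Y)$, $\sharp_g=\flat_g^{-1}$. Matrix notation: $\begin{pmatrix}H&\sigma\\ \tau&K\end{pmatrix}(X+\xi)=(HX+\sigma\xi)+(\tau X+K\xi)$. $\mathcal G_g(X+\xi,Y+\eta)=g(X,Y)+g(\sharp_g\xi,\sharp_g\eta)$; $\mathcal G_0(X+\xi,Y+\eta)=\frac12(\xi(Y)+\eta(X))$; $\Omega_0(X+\xi,Y+\eta)=\frac12(\xi(Y)-\eta(X))$. Generalized almost complex: $\mathfrak F(M)$-linear endomorphism $\mathcal J$ of $\Gamma(\mathbb TM)$ with $\mathcal J^2=-Id$. Generalized almost paracomplex: $\mathcal F^2=Id$ and the $\pm1$-eigenbundles have equal rank. $\mathcal K$ is isometric with respect to $\mathcal G$ if $\mathcal G(\mathcal Ku,\mathcal Kv)=\mathcal G(u,v)$ for all sections $u,v$. A pair $(\mathcal J,\mathcal G)$ with $\mathcal J^2=-Id$ isometric is generalized almost Hermitian (resp. indefinite almost Hermitian) if $\mathcal G$ is Riemannian (resp. pseudo-Riemannian). A pair $(\mathcal F,\mathcal G)$ with $\mathcal F^2=Id$ isometric is generalized pseudo-Riemannian almost product if $\mathcal G$ is pseudo-Riemannian, and generalized almost para-Norden if $\mathcal G$ is Riemannian and $\mathcal F$ is almost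 paracomplex. The fundamental tensor of $(\mathcal K,\mathcal G)$ is $\Phi_{\mathcal K}(u,v)=\mathcal G(\mathcal Ku,v)$ (here with $\mathcal G=\mathcal G_g$). *)

theory Defs
  imports "HOL-Analysis.Analysis" "HOL-Library.Function_Algebras"
begin

instantiation "fun" :: (type, real_vector) real_vector
begin

definition scaleR_fun :: "real \<Rightarrow> ('a \<Rightarrow> 'b) \<Rightarrow> 'a \<Rightarrow> 'b"
  where "scaleR_fun r f = (\<lambda>x. r *\<^sub>R f x)"

instance
  by standard (simp_all add: scaleR_fun_def fun_eq_iff scaleR_add_right scaleR_add_left)

end


section \<open>Smooth maps between open subsets of Euclidean spaces\<close>

primrec Ck_on :: "nat \<Rightarrow> 'e::euclidean_space set \<Rightarrow> ('e \<Rightarrow> 'f::euclidean_space) \<Rightarrow> bool" where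
  "Ck_on 0 S f \<longleftrightarrow> continuous_on S f"
| "Ck_on (Suc k) S f \<longleftrightarrow>
     (\<forall>x\<in>S. f differentiable (at x)) \<and> (\<forall>v. Ck_on k S (\<lambda>x. frechet_derivative f (at x) v))"

text \<open>Only meaningful for open sets, because of the unrestricted derivatives.\<close>
definition smooth_on :: "'e::euclidean_space set \<Rightarrow> ('e \<Rightarrow> 'f::euclidean_space) \<Rightarrow> bool" where
  "smooth_on S f \<longleftrightarrow> (\<forall>k. Ck_on k S f)"


section \<open>Smooth manifolds\<close>

text \<open>A chart is a pair of a domain and a coordinate map on it.\<close>
type_synonym ('a, 'e) chart = "'a set \<times> ('a \<Rightarrow> 'e)"

definition chart_im :: "('a, 'e) chart \<Rightarrow> 'e set" where
  "chart_im c = snd c ` fst c"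

definition chart_inv :: "('a, 'e) chart \<Rightarrow> 'e \<Rightarrow> 'a" where
  "chart_inv c = inv_into (fst c) (snd c)"

definition transition :: "('a, 'e) chart \<Rightarrow> ('a, 'e) chart \<Rightarrow> 'e \<Rightarrow> 'e" where
  "transition c d = snd d \<circ> chart_inv c"

definition points :: "('a, 'e) chart set \<Rightarrow> 'a set" where
  "points A = (\<Union>c\<in>A. fst c)"

definition smooth_manifold :: "'a topology \<Rightarrow> ('a, 'e::euclidean_space) chart set \<Rightarrow> bool" where
  "smooth_manifold T A \<longleftrightarrow>
     Hausdorff_space T \<and> second_countable T \<and>
     points A = topspace T \<and>
     (\<forall>c\<in>A. openin T (fst c) \<and> open (chart_im c) \<and>
        homeomorphic_map (subtopology T (fst c)) (top_of_set (chart_im c)) (snd c)) \<and>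
     (\<forall>c\<in>A. \<forall>d\<in>A. smooth_on (snd c ` (fst c \<inter> fst d)) (transition c d))"

text \<open>Functions on the manifold are represented by functions on the ambient type that vanish off
  the manifold; similarly for vector fields and 1-forms below.\<close>
definition smooth_functions :: "('a, 'e::euclidean_space) chart set \<Rightarrow> ('a \<Rightarrow> real) set" where
  "smooth_functions A = {f. (\<forall>p. p \<notin> points A \<longrightarrow> f p = 0) \<and>
     (\<forall>c\<in>A. smooth_on (chart_im c) (\<lambda>x. f (chart_inv c x)))}"


section \<open>Tangent and cotangent spaces, vector fields and 1-forms\<close>

text \<open>A tangent vector at a point is the family of its coordinate vectors in the charts around that
  point, subject to the transformation law under change of charts.\<close>
type_synonym ('a, 'e) tvec = "('a, 'e) chart \<Rightarrow> 'e"
type_synonym ('a, 'e) cvec = "('a, 'e) tvec \<Rightarrow> real"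

definition charts_at :: "('a, 'e) chart set \<Rightarrow> 'a \<Rightarrow> ('a, 'e) chart set" where
  "charts_at A p = {c \<in> A. p \<in> fst c}"

definition jacobian ::
  "('a, 'e::euclidean_space) chart \<Rightarrow> ('a, 'e) chart \<Rightarrow> 'a \<Rightarrow> 'e \<Rightarrow> 'e" where
  "jacobian c d p = frechet_derivative (transition c d) (at (snd c p))"

definition tangent_space ::
  "('a, 'e::euclidean_space) chart set \<Rightarrow> 'a \<Rightarrow> ('a, 'e) tvec set" where
  "tangent_space A p = {v. (\<forall>c. c \<notin> charts_at A p \<longrightarrow> v c = 0) \<and>
     (\<forall>c\<in>charts_at A p. \<forall>d\<in>charts_at A p. v d = jacobian c d p (v c))}"

definition linear_on :: "'v::real_vector set \<Rightarrow> ('v \<Rightarrow> 'w::real_vector) \<Rightarrow> bool" where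
  "linear_on V f \<longleftrightarrow> (\<forall>v\<in>V. \<forall>w\<in>V. f (v + w) = f v + f w) \<and> (\<forall>r. \<forall>v\<in>V. f (r *\<^sub>R v) = r *\<^sub>R f v)"

definition cotangent_space ::
  "('a, 'e::euclidean_space) chart set \<Rightarrow> 'a \<Rightarrow> ('a, 'e) cvec set" where
  "cotangent_space A p = {\<alpha>. linear_on (tangent_space A p) \<alpha> \<and>
     (\<forall>v. v \<notin> tangent_space A p \<longrightarrow> \<alpha> v = 0)}"

text \<open>The tangent vector whose coordinate vector in the chart \<open>c\<close> is \<open>e\<close>, and the covector
  \<open>\<Sum>i. a\<^sub>i dx\<^sup>i\<close> in the coordinates of the chart \<open>c\<close>, where \<open>a\<^sub>i\<close> are the components of \<open>a\<close>.\<close>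
definition coord_vec ::
  "('a, 'e::euclidean_space) chart set \<Rightarrow> ('a, 'e) chart \<Rightarrow> 'a \<Rightarrow> 'e \<Rightarrow> ('a, 'e) tvec" where
  "coord_vec A c p e = (\<lambda>d. if d \<in> charts_at A p then jacobian c d p e else 0)"

definition coord_covec ::
  "('a, 'e::euclidean_space) chart set \<Rightarrow> ('a, 'e) chart \<Rightarrow> 'a \<Rightarrow> 'e \<Rightarrow> ('a, 'e) cvec" where
  "coord_covec A c p a = (\<lambda>v. if v \<in> tangent_space A p then a \<bullet> v c else 0)"

definition vector_fields ::
  "('a, 'e::euclidean_space) chart set \<Rightarrow> ('a \<Rightarrow> ('a, 'e) tvec) set" where
  "vector_fields A = {X. (\<forall>p\<in>points A. X p \<in> tangent_space A p) \<and> (\<forall>p. p \<notin> points A \<longrightarrow> X p = 0) \<and>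
     (\<forall>c\<in>A. smooth_on (chart_im c) (\<lambda>x. X (chart_inv c x) c))}"

definition one_forms ::
  "('a, 'e::euclidean_space) chart set \<Rightarrow> ('a \<Rightarrow> ('a, 'e) cvec) set" where
  "one_forms A = {\<xi>. (\<forall>p\<in>points A. \<xi> p \<in> cotangent_space A p) \<and> (\<forall>p. p \<notin> points A \<longrightarrow> \<xi> p = 0) \<and>
     (\<forall>c\<in>A. \<forall>e. smooth_on (chart_im c) (\<lambda>x. \<xi> (chart_inv c x) (coord_vec A c (chart_inv c x) e)))}"


section \<open>Metrics\<close>

definition bilinear_form_on :: "'v::real_vector set \<Rightarrow> ('v \<Rightarrow> 'v \<Rightarrow> real) \<Rightarrow> bool" where
  "bilinear_form_on V b \<longleftrightarrow> (\<forall>v\<in>V. linear_on V (b v)) \<and> (\<forall>w\<in>V. linear_on V (\<lambda>v. b v w))"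

definition nondegenerate_symmetric_on :: "'v::real_vector set \<Rightarrow> ('v \<Rightarrow> 'v \<Rightarrow> real) \<Rightarrow> bool" where
  "nondegenerate_symmetric_on V b \<longleftrightarrow> bilinear_form_on V b \<and>
     (\<forall>v\<in>V. \<forall>w\<in>V. b v w = b w v) \<and>
     (\<forall>v\<in>V. (\<forall>w\<in>V. b v w = 0) \<longrightarrow> v = 0)"

definition positive_definite_on :: "'v::real_vector set \<Rightarrow> ('v \<Rightarrow> 'v \<Rightarrow> real) \<Rightarrow> bool" where
  "positive_definite_on V b \<longleftrightarrow> (\<forall>v\<in>V. v \<noteq> 0 \<longrightarrow> b v v > 0)"

type_synonym ('a, 'e) tensor2 = "'a \<Rightarrow> ('a, 'e) tvec \<Rightarrow> ('a, 'e) tvec \<Rightarrow> real"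

definition metric :: "('a, 'e::euclidean_space) chart set \<Rightarrow> ('a, 'e) tensor2 \<Rightarrow> bool" where
  "metric A g \<longleftrightarrow>
     (\<forall>p\<in>points A. nondegenerate_symmetric_on (tangent_space A p) (g p)) \<and>
     (\<forall>c\<in>A. \<forall>e e'. smooth_on (chart_im c) (\<lambda>x. let p = chart_inv c x in
        g p (coord_vec A c p e) (coord_vec A c p e')))"

definition riemannian :: "('a, 'e::euclidean_space) chart set \<Rightarrow> ('a, 'e) tensor2 \<Rightarrow> bool" where
  "riemannian A g \<longleftrightarrow> metric A g \<and> (\<forall>p\<in>points A. positive_definite_on (tangent_space A p) (g p))"

definition pseudo_riemannian :: "('a, 'e::euclidean_space) chart set \<Rightarrow> ('a, 'e) tensor2 \<Rightarrow> bool" where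
  "pseudo_riemannian A g \<longleftrightarrow>
     metric A g \<and> \<not> (\<forall>p\<in>points A. positive_definite_on (tangent_space A p) (g p))"

definition flat_at ::
  "('a, 'e::euclidean_space) chart set \<Rightarrow> ('a, 'e) tensor2 \<Rightarrow> 'a \<Rightarrow> ('a, 'e) tvec \<Rightarrow> ('a, 'e) cvec" where
  "flat_at A g p v = (\<lambda>w. if w \<in> tangent_space A p then g p v w else 0)"

definition sharp_at ::
  "('a, 'e::euclidean_space) chart set \<Rightarrow> ('a, 'e) tensor2 \<Rightarrow> 'a \<Rightarrow> ('a, 'e) cvec \<Rightarrow> ('a, 'e) tvec" where
  "sharp_at A g p = inv_into (tangent_space A p) (flat_at A g p)"

definition flat ::
  "('a, 'e::euclidean_space) chart set \<Rightarrow> ('a, 'e) tensor2 \<Rightarrow>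
   ('a \<Rightarrow> ('a, 'e) tvec) \<Rightarrow> 'a \<Rightarrow> ('a, 'e) cvec" where
  "flat A g X = (\<lambda>p. if p \<in> points A then flat_at A g p (X p) else 0)"

definition sharp ::
  "('a, 'e::euclidean_space) chart set \<Rightarrow> ('a, 'e) tensor2 \<Rightarrow>
   ('a \<Rightarrow> ('a, 'e) cvec) \<Rightarrow> 'a \<Rightarrow> ('a, 'e) tvec" where
  "sharp A g \<xi> = (\<lambda>p. if p \<in> points A then sharp_at A g p (\<xi> p) else 0)"


section \<open>The generalized tangent bundle\<close>

type_synonym ('a, 'e) gvec = "('a, 'e) tvec \<times> ('a, 'e) cvec"

text \<open>The section \<open>X + \<xi>\<close> of the generalized tangent bundle is the pair \<open>(X, \<xi>)\<close>.\<close>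
type_synonym ('a, 'e) gsec = "('a \<Rightarrow> ('a, 'e) tvec) \<times> ('a \<Rightarrow> ('a, 'e) cvec)"

definition gen_space :: "('a, 'e::euclidean_space) chart set \<Rightarrow> 'a \<Rightarrow> ('a, 'e) gvec set" where
  "gen_space A p = tangent_space A p \<times> cotangent_space A p"

definition gen_sections :: "('a, 'e::euclidean_space) chart set \<Rightarrow> ('a, 'e) gsec set" where
  "gen_sections A = vector_fields A \<times> one_forms A"

definition sec_at :: "('a, 'e) gsec \<Rightarrow> 'a \<Rightarrow> ('a, 'e) gvec" where
  "sec_at u p = (fst u p, snd u p)"

definition smul_sec :: "('a \<Rightarrow> real) \<Rightarrow> ('a, 'e::euclidean_space) gsec \<Rightarrow> ('a, 'e) gsec" where
  "smul_sec f u = ((\<lambda>p. f p *\<^sub>R fst u p), (\<lambda>p. f p *\<^sub>R snd u p))"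

definition gen_endomorphism ::
  "('a, 'e::euclidean_space) chart set \<Rightarrow> (('a, 'e) gsec \<Rightarrow> ('a, 'e) gsec) \<Rightarrow> bool" where
  "gen_endomorphism A K \<longleftrightarrow>
     (\<forall>u\<in>gen_sections A. K u \<in> gen_sections A) \<and>
     (\<forall>u\<in>gen_sections A. \<forall>v\<in>gen_sections A. K (u + v) = K u + K v) \<and>
     (\<forall>f\<in>smooth_functions A. \<forall>u\<in>gen_sections A. K (smul_sec f u) = smul_sec f (K u))"

definition block_matrix ::
  "(('a \<Rightarrow> ('a, 'e::euclidean_space) tvec) \<Rightarrow> ('a \<Rightarrow> ('a, 'e) tvec)) \<Rightarrow>
   (('a \<Rightarrow> ('a, 'e) cvec) \<Rightarrow> ('a \<Rightarrow> ('a, 'e) tvec)) \<Rightarrow>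
   (('a \<Rightarrow> ('a, 'e) tvec) \<Rightarrow> ('a \<Rightarrow> ('a, 'e) cvec)) \<Rightarrow>
   (('a \<Rightarrow> ('a, 'e) cvec) \<Rightarrow> ('a \<Rightarrow> ('a, 'e) cvec)) \<Rightarrow>
   ('a, 'e) gsec \<Rightarrow> ('a, 'e) gsec" where
  "block_matrix H \<sigma> \<tau> K = (\<lambda>(X, \<xi>). (H X + \<sigma> \<xi>, \<tau> X + K \<xi>))"

definition gen_almost_complex ::
  "('a, 'e::euclidean_space) chart set \<Rightarrow> (('a, 'e) gsec \<Rightarrow> ('a, 'e) gsec) \<Rightarrow> bool" where
  "gen_almost_complex A J \<longleftrightarrow> gen_endomorphism A J \<and> (\<forall>u\<in>gen_sections A. J (J u) = - u)"

definition gen_almost_product ::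
  "('a, 'e::euclidean_space) chart set \<Rightarrow> (('a, 'e) gsec \<Rightarrow> ('a, 'e) gsec) \<Rightarrow> bool" where
  "gen_almost_product A F \<longleftrightarrow> gen_endomorphism A F \<and> (\<forall>u\<in>gen_sections A. F (F u) = u)"

text \<open>The fibre at \<open>p\<close> of the \<open>s\<close>-eigenbundle: the values at \<open>p\<close> of the eigensections.\<close>
definition eigenbundle_at ::
  "('a, 'e::euclidean_space) chart set \<Rightarrow> (('a, 'e) gsec \<Rightarrow> ('a, 'e) gsec) \<Rightarrow> real \<Rightarrow> 'a \<Rightarrow>
   ('a, 'e) gvec set" where
  "eigenbundle_at A F s p = {sec_at u p |u. u \<in> gen_sections A \<and> F u = s *\<^sub>R u}"

definition gen_almost_paracomplex ::
  "('a, 'e::euclidean_space) chart set \<Rightarrow> (('a, 'e) gsec \<Rightarrow> ('a, 'e) gsec) \<Rightarrow> bool" where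
  "gen_almost_paracomplex A F \<longleftrightarrow> gen_almost_product A F \<and>
     (\<forall>p\<in>points A. dim (eigenbundle_at A F 1 p) = dim (eigenbundle_at A F (-1) p))"


section \<open>Generalized metrics\<close>

type_synonym ('a, 'e) gtensor2 = "'a \<Rightarrow> ('a, 'e) gvec \<Rightarrow> ('a, 'e) gvec \<Rightarrow> real"

definition gen_metric :: "('a, 'e::euclidean_space) chart set \<Rightarrow> ('a, 'e) gtensor2 \<Rightarrow> bool" where
  "gen_metric A G \<longleftrightarrow>
     (\<forall>p\<in>points A. nondegenerate_symmetric_on (gen_space A p) (G p)) \<and>
     (\<forall>c\<in>A. \<forall>e a e' a'. smooth_on (chart_im c) (\<lambda>x. let p = chart_inv c x in
        G p (coord_vec A c p e, coord_covec A c p a) (coord_vec A c p e', coord_covec A c p a')))"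

definition gen_riemannian :: "('a, 'e::euclidean_space) chart set \<Rightarrow> ('a, 'e) gtensor2 \<Rightarrow> bool" where
  "gen_riemannian A G \<longleftrightarrow>
     gen_metric A G \<and> (\<forall>p\<in>points A. positive_definite_on (gen_space A p) (G p))"

definition gen_pseudo_riemannian ::
  "('a, 'e::euclidean_space) chart set \<Rightarrow> ('a, 'e) gtensor2 \<Rightarrow> bool" where
  "gen_pseudo_riemannian A G \<longleftrightarrow>
     gen_metric A G \<and> \<not> (\<forall>p\<in>points A. positive_definite_on (gen_space A p) (G p))"

definition apply_tensor :: "('a, 'e) gtensor2 \<Rightarrow> ('a, 'e) gsec \<Rightarrow> ('a, 'e) gsec \<Rightarrow> 'a \<Rightarrow> real" where
  "apply_tensor G u v = (\<lambda>p. G p (sec_at u p) (sec_at v p))"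

definition isometric ::
  "('a, 'e::euclidean_space) chart set \<Rightarrow> (('a, 'e) gsec \<Rightarrow> ('a, 'e) gsec) \<Rightarrow>
   ('a, 'e) gtensor2 \<Rightarrow> bool" where
  "isometric A K G \<longleftrightarrow> (\<forall>u\<in>gen_sections A. \<forall>v\<in>gen_sections A. \<forall>p\<in>points A.
     apply_tensor G (K u) (K v) p = apply_tensor G u v p)"

definition fundamental_tensor ::
  "(('a, 'e) gsec \<Rightarrow> ('a, 'e) gsec) \<Rightarrow> ('a, 'e) gtensor2 \<Rightarrow>
   ('a, 'e) gsec \<Rightarrow> ('a, 'e) gsec \<Rightarrow> 'a \<Rightarrow> real" where
  "fundamental_tensor K G u v = apply_tensor G (K u) v"

definition gen_almost_hermitian ::
  "('a, 'e::euclidean_space) chart set \<Rightarrow> (('a, 'e) gsec \<Rightarrow> ('a, 'e) gsec) \<Rightarrow>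
   ('a, 'e) gtensor2 \<Rightarrow> bool" where
  "gen_almost_hermitian A J G \<longleftrightarrow> gen_almost_complex A J \<and> isometric A J G \<and> gen_riemannian A G"

definition gen_indefinite_almost_hermitian ::
  "('a, 'e::euclidean_space) chart set \<Rightarrow> (('a, 'e) gsec \<Rightarrow> ('a, 'e) gsec) \<Rightarrow>
   ('a, 'e) gtensor2 \<Rightarrow> bool" where
  "gen_indefinite_almost_hermitian A J G \<longleftrightarrow>
     gen_almost_complex A J \<and> isometric A J G \<and> gen_pseudo_riemannian A G"

definition gen_almost_para_norden ::
  "('a, 'e::euclidean_space) chart set \<Rightarrow> (('a, 'e) gsec \<Rightarrow> ('a, 'e) gsec) \<Rightarrow>
   ('a, 'e) gtensor2 \<Rightarrow> bool" where
  "gen_almost_para_norden A F G \<longleftrightarrow>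
     gen_almost_paracomplex A F \<and> isometric A F G \<and> gen_riemannian A G"

definition gen_pseudo_riemannian_almost_product ::
  "('a, 'e::euclidean_space) chart set \<Rightarrow> (('a, 'e) gsec \<Rightarrow> ('a, 'e) gsec) \<Rightarrow>
   ('a, 'e) gtensor2 \<Rightarrow> bool" where
  "gen_pseudo_riemannian_almost_product A F G \<longleftrightarrow>
     gen_almost_product A F \<and> isometric A F G \<and> gen_pseudo_riemannian A G"


section \<open>Structures induced by a metric\<close>

definition induced_metric ::
  "('a, 'e::euclidean_space) chart set \<Rightarrow> ('a, 'e) tensor2 \<Rightarrow> ('a, 'e) gtensor2" where
  "induced_metric A g p = (\<lambda>(v, \<alpha>) (w, \<beta>). g p v w + g p (sharp_at A g p \<alpha>) (sharp_at A g p \<beta>))"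

definition G0 :: "('a, 'e) gsec \<Rightarrow> ('a, 'e) gsec \<Rightarrow> 'a \<Rightarrow> real" where
  "G0 = (\<lambda>(X, \<xi>) (Y, \<eta>) p. 1/2 * (\<xi> p (Y p) + \<eta> p (X p)))"

definition Omega0 :: "('a, 'e) gsec \<Rightarrow> ('a, 'e) gsec \<Rightarrow> 'a \<Rightarrow> real" where
  "Omega0 = (\<lambda>(X, \<xi>) (Y, \<eta>) p. 1/2 * (\<xi> p (Y p) - \<eta> p (X p)))"

definition J_of ::
  "('a, 'e::euclidean_space) chart set \<Rightarrow> ('a, 'e) tensor2 \<Rightarrow> ('a, 'e) gsec \<Rightarrow> ('a, 'e) gsec" where
  "J_of A g = block_matrix (\<lambda>X. 0) (\<lambda>\<xi>. - sharp A g \<xi>) (flat A g) (\<lambda>\<xi>. 0)"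

definition F_of ::
  "('a, 'e::euclidean_space) chart set \<Rightarrow> ('a, 'e) tensor2 \<Rightarrow> ('a, 'e) gsec \<Rightarrow> ('a, 'e) gsec" where
  "F_of A g = block_matrix (\<lambda>X. 0) (sharp A g) (flat A g) (\<lambda>\<xi>. 0)"

end

theory Submission
  imports Defs
begin

text \<open>Pointwise everything reduces to \<open>g(\<sharp>\<alpha>, w) = \<alpha>(w)\<close> and to \<open>\<flat>\<close>, \<open>\<sharp>\<close> being mutually inverse; a chart
  identifies each tangent space with the model space, where nondegeneracy makes the Gram matrix of
  \<open>g\<close> invertible. The analytic point is that \<open>\<sharp>\<close> maps smooth 1-forms to smooth vector fields: in a
  chart the components of \<open>\<sharp>\<xi>\<close> solve a linear system with smooth invertible coefficients, and such
  solutions are smooth. The eigenbundles of the paracomplex structure are exchanged by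
  \<open>X + \<xi> \<mapsto> X - \<xi>\<close>, hence have equal rank.\<close>

section \<open>Calculus of \<open>C\<^sup>k\<close> maps\<close>

text \<open>Tangent spaces are subsets of a function type without Euclidean structure, so
  finite-dimensional arguments are carried to \<open>'e\<close> through a chart, and linear systems
  are posed as families of linear maps \<open>M x\<close> on \<open>'e\<close> rather than through
  inverse matrices given by determinants. The smoothness of a solution \<open>Y\<close> faces a
  circularity: the system can be differentiated only once \<open>Y\<close> is known to be
  differentiable. Freezing the matrix at a point \<open>x\<close> breaks it. In
  \<open>M x (Y y) = b y - (M y - M x) (Y y)\<close> the factor \<open>M y - M x\<close> vanishes at
  \<open>y = x\<close>, and the product of a continuous function with a differentiable one that
  vanishes at the point is differentiable there. Continuity of \<open>Y\<close> comes from the lower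
  bound of an injective linear map, which survives small perturbations.\<close>

lemma Ck_on_cong:
  assumes "open S" and "\<And>x. x \<in> S \<Longrightarrow> f x = g x" and "Ck_on k S f"
  shows "Ck_on k S g"
  using assms(2,3)
proof (induction k arbitrary: f g)
  case 0
  then show ?case
    using continuous_on_cong by force
next
  case (Suc k)
  have deriv: "(g has_derivative frechet_derivative f (at x)) (at x)" if "x \<in> S" for x
  proof (rule has_derivative_transform_within_open)
    show "(f has_derivative frechet_derivative f (at x)) (at x)"
      using Suc.prems(2) that frechet_derivative_works by auto
  qed (use that assms(1) Suc.prems(1) in auto)
  have "Ck_on k S (\<lambda>x. frechet_derivative g (at x) v)" for v
  proof (rule Suc.IH)
    show "frechet_derivative f (at x) v = frechet_derivative g (at x) v" if "x \<in> S" for x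
      using frechet_derivative_at[OF deriv[OF that]] by simp
  qed (use Suc.prems(2) in auto)
  then show ?case
    using deriv by (auto simp: differentiable_def)
qed

text \<open>By uniqueness of derivatives, any explicit formula \<open>f'\<close> may stand for
  \<open>frechet_derivative\<close>. The inductions on the order that follow produce such a formula
  and its regularity.\<close>

lemma Ck_on_SucI:
  assumes "open S" and deriv: "\<And>x. x \<in> S \<Longrightarrow> (f has_derivative f' x) (at x)"
    and "\<And>v. Ck_on k S (\<lambda>x. f' x v)"
  shows "Ck_on (Suc k) S f"
proof -
  have "Ck_on k S (\<lambda>x. frechet_derivative f (at x) v)" for v
  proof (rule Ck_on_cong[OF assms(1) _ assms(3)])
    show "f' x v = frechet_derivative f (at x) v" if "x \<in> S" for x
      using frechet_derivative_at[OF deriv[OF that]] by simp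
  qed
  then show ?thesis
    using deriv by (auto simp: differentiable_def)
qed

lemma Ck_on_Suc_has_derivative:
  assumes "Ck_on (Suc k) S f" and "x \<in> S"
  shows "(f has_derivative frechet_derivative f (at x)) (at x)"
  using assms frechet_derivative_works by auto

lemma Ck_on_Suc_imp_Ck_on: "Ck_on (Suc k) S f \<Longrightarrow> Ck_on k S f"
proof (induction k arbitrary: f)
  case 0
  then show ?case
    by (auto intro!: continuous_at_imp_continuous_on differentiable_imp_continuous_within)
next
  case (Suc k)
  then show ?case
    by (metis Ck_on.simps(2))
qed

lemma Ck_on_const: "Ck_on k S (\<lambda>x. c)"
  by (induction k arbitrary: c) auto

lemma Ck_on_add:
  assumes "open S"
  shows "Ck_on k S f \<Longrightarrow> Ck_on k S g \<Longrightarrow> Ck_on k S (\<lambda>x. f x + g x)"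
proof (induction k arbitrary: f g)
  case 0
  then show ?case
    by (auto intro: continuous_on_add)
next
  case (Suc k)
  show ?case
  proof (rule Ck_on_SucI[OF assms])
    show "((\<lambda>x. f x + g x) has_derivative
        (\<lambda>v. frechet_derivative f (at x) v + frechet_derivative g (at x) v)) (at x)"
      if "x \<in> S" for x
      by (intro has_derivative_add Suc.prems[THEN Ck_on_Suc_has_derivative, OF that])
  qed (use Suc in auto)
qed

lemma Ck_on_bounded_linear:
  assumes "open S" and "bounded_linear L"
  shows "Ck_on k S f \<Longrightarrow> Ck_on k S (\<lambda>x. L (f x))"
proof (induction k arbitrary: f)
  case 0
  then show ?case
    using assms(2) by (simp add: bounded_linear.continuous_on)
next
  case (Suc k)
  show ?case
  proof (rule Ck_on_SucI[OF assms(1)])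
    show "((\<lambda>x. L (f x)) has_derivative (\<lambda>v. L (frechet_derivative f (at x) v))) (at x)"
      if "x \<in> S" for x
      by (intro bounded_linear.has_derivative[OF assms(2)] Suc.prems[THEN Ck_on_Suc_has_derivative, OF that])
  qed (use Suc in auto)
qed

lemma Ck_on_scaleR:
  assumes "open S"
  shows "Ck_on k S f \<Longrightarrow> Ck_on k S g \<Longrightarrow> Ck_on k S (\<lambda>x. f x *\<^sub>R g x)"
proof (induction k arbitrary: f g)
  case 0
  then show ?case
    by (auto intro: continuous_on_scaleR)
next
  case (Suc k)
  show ?case
  proof (rule Ck_on_SucI[OF assms])
    show "((\<lambda>x. f x *\<^sub>R g x) has_derivative
        (\<lambda>v. f x *\<^sub>R frechet_derivative g (at x) v + frechet_derivative f (at x) v *\<^sub>R g x)) (at x)"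
      if "x \<in> S" for x
      by (intro has_derivative_scaleR Suc.prems[THEN Ck_on_Suc_has_derivative, OF that])
    \<comment> \<open>Each summand pairs one factor with a derivative of the other, so the
      undifferentiated factor is needed only at order \<open>k\<close>.\<close>
    show "Ck_on k S (\<lambda>x. f x *\<^sub>R frechet_derivative g (at x) v + frechet_derivative f (at x) v *\<^sub>R g x)"
      for v
      by (intro Ck_on_add[OF assms] Suc.IH) (use Suc.prems Ck_on_Suc_imp_Ck_on in auto)
  qed
qed

lemma Ck_on_sum:
  assumes "open S" and "\<And>i. i \<in> I \<Longrightarrow> Ck_on k S (f i)"
  shows "Ck_on k S (\<lambda>x. \<Sum>i\<in>I. f i x)"
  using assms(2)
  by (induction I rule: infinite_finite_induct) (auto intro: Ck_on_const Ck_on_add[OF assms(1)])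

text \<open>The error splits into \<open>f y\<close> times the error of \<open>h\<close>, which is
  small because \<open>f\<close> is bounded near \<open>x\<close>, and
  \<open>(f y - f x) *\<^sub>R h' (y - x)\<close>, which is small because \<open>f\<close> is
  continuous and \<open>h'\<close> bounded. The term \<open>(f y - f x) *\<^sub>R h x\<close> is
  zero.\<close>

lemma has_derivative_scaleR_vanishing:
  fixes f :: "'a::real_normed_vector \<Rightarrow> real"
  assumes f: "isCont f x" and h: "(h has_derivative h') (at x)" and "h x = 0"
  shows "((\<lambda>y. f y *\<^sub>R h y) has_derivative (\<lambda>v. f x *\<^sub>R h' v)) (at x)"
proof -
  interpret h': bounded_linear h'
    using h by (rule has_derivative_bounded_linear)
  obtain K where K: "\<And>v. norm (h' v) \<le> norm v * K"
    using h'.bounded by blast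
  have lim: "((\<lambda>y. norm (h y - h x - h' (y - x)) / norm (y - x)) \<longlongrightarrow> 0) (at x)"
    using h by (simp add: has_derivative_iff_norm)
  have f0: "((\<lambda>y. \<bar>f y - f x\<bar>) \<longlongrightarrow> 0) (at x)"
    using f by (simp add: isCont_def LIM_zero tendsto_rabs_zero)
  have fx: "((\<lambda>y. \<bar>f y\<bar>) \<longlongrightarrow> \<bar>f x\<bar>) (at x)"
    using f by (simp add: isCont_def tendsto_rabs)
  have "((\<lambda>y. \<bar>f y\<bar> * (norm (h y - h x - h' (y - x)) / norm (y - x)) + \<bar>f y - f x\<bar> * K)
      \<longlongrightarrow> \<bar>f x\<bar> * 0 + 0 * K) (at x)"
    by (intro tendsto_intros lim f0 fx)
  then have "((\<lambda>y. \<bar>f y\<bar> * (norm (h y - h x - h' (y - x)) / norm (y - x)) + \<bar>f y - f x\<bar> * K)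
      \<longlongrightarrow> 0) (at x)"
    by simp
  moreover have "norm (norm (f y *\<^sub>R h y - f x *\<^sub>R h x - f x *\<^sub>R h' (y - x)) / norm (y - x))
      \<le> \<bar>f y\<bar> * (norm (h y - h x - h' (y - x)) / norm (y - x)) + \<bar>f y - f x\<bar> * K" if "y \<noteq> x" for y
  proof -
    have "f y *\<^sub>R h y - f x *\<^sub>R h x - f x *\<^sub>R h' (y - x)
        = f y *\<^sub>R (h y - h x - h' (y - x)) + (f y - f x) *\<^sub>R h' (y - x)"
      using assms(3) by (simp add: algebra_simps)
    then have "norm (f y *\<^sub>R h y - f x *\<^sub>R h x - f x *\<^sub>R h' (y - x))
        \<le> \<bar>f y\<bar> * norm (h y - h x - h' (y - x)) + \<bar>f y - f x\<bar> * norm (h' (y - x))"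
      by (metis norm_scaleR norm_triangle_ineq)
    also have "\<dots> \<le> \<bar>f y\<bar> * norm (h y - h x - h' (y - x)) + \<bar>f y - f x\<bar> * (norm (y - x) * K)"
      by (intro add_left_mono mult_left_mono K) auto
    finally show ?thesis
      using that by (simp add: field_simps)
  qed
  then have "eventually (\<lambda>y. norm (norm (f y *\<^sub>R h y - f x *\<^sub>R h x - f x *\<^sub>R h' (y - x)) / norm (y - x))
      \<le> \<bar>f y\<bar> * (norm (h y - h x - h' (y - x)) / norm (y - x)) + \<bar>f y - f x\<bar> * K) (at x)"
    by (auto simp: eventually_at_filter)
  ultimately have "((\<lambda>y. norm (f y *\<^sub>R h y - f x *\<^sub>R h x - f x *\<^sub>R h' (y - x)) / norm (y - x))
      \<longlongrightarrow> 0) (at x)"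
    by (rule Lim_null_comparison[rotated])
  then show ?thesis
    unfolding has_derivative_iff_norm
    using h'.bounded_linear_axioms by (simp add: bounded_linear_const_scaleR)
qed

section \<open>Linear systems depending on a parameter\<close>

lemma linear_expand:
  fixes L :: "'e::euclidean_space \<Rightarrow> 'f::real_vector"
  assumes "linear L"
  shows "L y = (\<Sum>i\<in>Basis. (y \<bullet> i) *\<^sub>R L i)"
proof -
  have "L y = L (\<Sum>i\<in>Basis. (y \<bullet> i) *\<^sub>R i)"
    by (simp only: euclidean_representation)
  also have "\<dots> = (\<Sum>i\<in>Basis. (y \<bullet> i) *\<^sub>R L i)"
    by (simp only: linear_sum[OF assms] linear_cmul[OF assms])
  finally show ?thesis .
qed

text \<open>\<open>M a\<close> is bounded below by \<open>c\<close>, hence \<open>M x\<close> by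
  \<open>c / 2\<close> for \<open>x\<close> near \<open>a\<close>. Applied to
  \<open>Y x - Y a\<close>, whose image under \<open>M x\<close> is \<open>b x - M x (Y a)\<close>,
  this bounds the difference by a quantity tending to 0.\<close>

lemma isCont_linear_solve:
  fixes M :: "'x::euclidean_space \<Rightarrow> 'e::euclidean_space \<Rightarrow> 'e"
  assumes "open S" and lin: "\<And>x. x \<in> S \<Longrightarrow> linear (M x)" and inj: "\<And>x. x \<in> S \<Longrightarrow> inj (M x)"
    and cont: "\<And>e. continuous_on S (\<lambda>x. M x e)" and contb: "continuous_on S b"
    and sol: "\<And>x. x \<in> S \<Longrightarrow> M x (Y x) = b x" and "a \<in> S"
  shows "isCont Y a"
proof -
  obtain c where c: "c > 0" "\<And>y. c * norm y \<le> norm (M a y)"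
    using linear_inj_bounded_below_pos[OF lin inj] \<open>a \<in> S\<close> by metis
  have contM: "((\<lambda>x. M x e) \<longlongrightarrow> M a e) (at a)" for e
    using cont[of e] assms(1) \<open>a \<in> S\<close> by (metis continuous_on_def at_within_open)
  have limb: "(b \<longlongrightarrow> b a) (at a)"
    using contb assms(1) \<open>a \<in> S\<close> by (metis continuous_on_def at_within_open)
  \<comment> \<open>\<open>d x\<close> dominates the operator norm of \<open>M x - M a\<close>, so
    convergence on each basis vector gives an estimate uniform in the argument.\<close>
  define d where "d x = (\<Sum>i\<in>Basis. norm (M x i - M a i))" for x
  have "(d \<longlongrightarrow> (\<Sum>i\<in>Basis. norm (M a i - M a i))) (at a)"
    unfolding d_def by (intro tendsto_intros contM)
  then have "(d \<longlongrightarrow> 0) (at a)"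
    by simp
  then have "eventually (\<lambda>x. d x < c / 2) (at a)"
    using c(1) by (intro order_tendstoD) auto
  moreover have "eventually (\<lambda>x. x \<in> S) (at a)"
    using assms(1) \<open>a \<in> S\<close> eventually_at_in_open' by blast
  ultimately have ev: "eventually (\<lambda>x. norm (Y x - Y a) \<le> 2 / c * norm (b x - M x (Y a))) (at a)"
  proof eventually_elim
    case (elim x)
    let ?y = "Y x - Y a"
    have "M x ?y - M a ?y = (\<Sum>i\<in>Basis. (?y \<bullet> i) *\<^sub>R (M x i - M a i))"
      using linear_expand[OF lin[OF elim(2)], of ?y] linear_expand[OF lin[OF \<open>a \<in> S\<close>], of ?y]
      by (simp add: scaleR_diff_right sum_subtractf)
    also have "norm \<dots> \<le> (\<Sum>i\<in>Basis. norm ((?y \<bullet> i) *\<^sub>R (M x i - M a i)))"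
      by (rule norm_sum)
    also have "\<dots> \<le> (\<Sum>i\<in>Basis. norm ?y * norm (M x i - M a i))"
      by (intro sum_mono) (auto intro!: mult_right_mono Basis_le_norm)
    also have "\<dots> = norm ?y * d x"
      by (simp add: d_def sum_distrib_left)
    also have "\<dots> \<le> norm ?y * (c / 2)"
      using elim(1) by (intro mult_left_mono) auto
    finally have "norm (M a ?y) \<le> norm (M x ?y) + norm ?y * (c / 2)"
      using norm_triangle_ineq3[of "M a ?y" "M x ?y"] norm_minus_commute[of "M a ?y" "M x ?y"]
      by linarith
    then have "c / 2 * norm ?y \<le> norm (M x ?y)"
      using c(2)[of ?y] by (simp add: algebra_simps)
    moreover have "M x ?y = b x - M x (Y a)"
      using sol[OF elim(2)] linear_diff[OF lin[OF elim(2)]] by simp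
    ultimately show ?case
      using c(1) by (simp add: field_simps)
  qed
  have "((\<lambda>x. 2 / c * norm (b x - M x (Y a))) \<longlongrightarrow> 2 / c * norm (b a - M a (Y a))) (at a)"
    by (intro tendsto_intros contM limb)
  then have "((\<lambda>x. 2 / c * norm (b x - M x (Y a))) \<longlongrightarrow> 0) (at a)"
    using sol[OF \<open>a \<in> S\<close>] by simp
  from Lim_null_comparison[OF ev this] show ?thesis
    by (simp add: isCont_def LIM_zero_iff)
qed

text \<open>Differentiating \<open>M x (Y x) = b x\<close> shows that every directional derivative of \<open>Y\<close> solves a
  system with the same matrix, whose right-hand side is as regular as \<open>Y\<close> and the derivative of
  \<open>b\<close>.\<close>
lemma Ck_on_linear_solve:
  fixes M :: "'x::euclidean_space \<Rightarrow> 'e::euclidean_space \<Rightarrow> 'e"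
  assumes S: "open S" and lin: "\<And>x. x \<in> S \<Longrightarrow> linear (M x)" and inj: "\<And>x. x \<in> S \<Longrightarrow> inj (M x)"
    and M: "\<And>e. Ck_on k S (\<lambda>x. M x e)" and b: "Ck_on k S b"
    and sol: "\<And>x. x \<in> S \<Longrightarrow> M x (Y x) = b x"
  shows "Ck_on k S Y"
  using M b sol
proof (induction k arbitrary: b Y)
  case 0
  show ?case
    using isCont_linear_solve[OF S lin inj _ _ "0.prems"(3)] "0.prems"
    by (auto intro: continuous_at_imp_continuous_on)
next
  case (Suc k)
  have contY: "isCont Y x" if "x \<in> S" for x
  proof (rule isCont_linear_solve[OF S lin inj _ _ Suc.prems(3)])
    show "continuous_on S (\<lambda>x. M x e)" for e
      using Suc.prems(1) by (auto intro!: continuous_at_imp_continuous_on differentiable_imp_continuous_within)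
    show "continuous_on S b"
      using Suc.prems(2) by (auto intro!: continuous_at_imp_continuous_on differentiable_imp_continuous_within)
  qed (use that in auto)
  have M_k: "Ck_on k S (\<lambda>x. M x e)" for e
    using Suc.prems(1) by (rule Ck_on_Suc_imp_Ck_on)
  \<comment> \<open>The right-hand side \<open>D\<close> below contains \<open>Y\<close> itself, so
    regularity of \<open>Y\<close> at order \<open>k\<close> has to come first.\<close>
  have Y_k: "Ck_on k S Y"
    by (rule Suc.IH[OF M_k Ck_on_Suc_imp_Ck_on[OF Suc.prems(2)] Suc.prems(3)])
  \<comment> \<open>Differentiating \<open>M x (Y x) = b x\<close> in direction \<open>v\<close>
    equates \<open>M x\<close>, applied to the derivative of \<open>Y\<close>, with this
    expression.\<close>
  define D where "D x v = frechet_derivative b (at x) v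
      - (\<Sum>i\<in>Basis. (Y x \<bullet> i) *\<^sub>R frechet_derivative (\<lambda>x. M x i) (at x) v)" for x v
  have bij: "bij (M x)" if "x \<in> S" for x
    using linear_injective_imp_surjective[OF lin inj] that inj by (auto simp: bij_def)
  show ?case
  proof (rule Ck_on_SucI[OF S])
    show "(Y has_derivative (\<lambda>v. inv (M x) (D x v))) (at x)" if x: "x \<in> S" for x
    proof -
      have linN: "linear (inv (M x))"
        using lin[OF x] bij[OF x] by (simp add: inj_linear_imp_inv_linear bij_is_inj)
      \<comment> \<open>On \<open>S\<close> this function of \<open>y\<close> is
        \<open>M x (Y y)\<close> with \<open>x\<close> frozen; the inverse of the constant map
        \<open>M x\<close> then turns its derivative into that of \<open>Y\<close>.\<close>
      have "((\<lambda>y. b y - (\<Sum>i\<in>Basis. (Y y \<bullet> i) *\<^sub>R (M y i - M x i))) has_derivative D x) (at x)"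
        unfolding D_def
      proof (intro has_derivative_diff has_derivative_sum has_derivative_scaleR_vanishing
          Ck_on_Suc_has_derivative[OF Suc.prems(2) x])
        fix i
        show "isCont (\<lambda>y. Y y \<bullet> i) x"
          using contY[OF x] by (intro continuous_intros)
        show "((\<lambda>y. M y i - M x i) has_derivative frechet_derivative (\<lambda>x. M x i) (at x)) (at x)"
          using has_derivative_diff[OF Ck_on_Suc_has_derivative[OF Suc.prems(1) x] has_derivative_const]
          by simp
      qed auto
      from bounded_linear.has_derivative[OF linear_conv_bounded_linear[THEN iffD1, OF linN] this]
      show ?thesis
      proof (rule has_derivative_transform_within_open[OF _ S x])
        fix y assume y: "y \<in> S"
        have "M x (Y y) = b y - (\<Sum>i\<in>Basis. (Y y \<bullet> i) *\<^sub>R (M y i - M x i))"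
          using linear_expand[OF lin[OF y], of "Y y"] linear_expand[OF lin[OF x], of "Y y"]
            Suc.prems(3)[OF y]
          by (simp add: scaleR_diff_right sum_subtractf)
        then show "inv (M x) (b y - (\<Sum>i\<in>Basis. (Y y \<bullet> i) *\<^sub>R (M y i - M x i))) = Y y"
          using inv_f_f[OF inj[OF x]] by metis
      qed
    qed
    show "Ck_on k S (\<lambda>x. inv (M x) (D x v))" for v
    proof (rule Suc.IH[OF M_k])
      have "Ck_on k S (\<lambda>x. frechet_derivative b (at x) v
          + (-1) *\<^sub>R (\<Sum>i\<in>Basis. (Y x \<bullet> i) *\<^sub>R frechet_derivative (\<lambda>x. M x i) (at x) v))"
        using Suc.prems(1,2)
        by (intro Ck_on_add[OF S] Ck_on_scaleR[OF S] Ck_on_const Ck_on_sum[OF S]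
            Ck_on_bounded_linear[OF S bounded_linear_inner_left] Y_k) auto
      then show "Ck_on k S (\<lambda>x. D x v)"
        by (simp add: D_def)
      show "M x (inv (M x) (D x v)) = D x v" if "x \<in> S" for x
        using bij[OF that] by (simp add: bij_is_surj surj_f_inv_f)
    qed
  qed
qed

section \<open>Smooth maps\<close>

lemma smooth_onI: "(\<And>k. Ck_on k S f) \<Longrightarrow> smooth_on S f"
  by (simp add: smooth_on_def)

lemma smooth_onD: "smooth_on S f \<Longrightarrow> Ck_on k S f"
  by (simp add: smooth_on_def)

lemma smooth_on_cong:
  "open S \<Longrightarrow> (\<And>x. x \<in> S \<Longrightarrow> f x = g x) \<Longrightarrow> smooth_on S f \<Longrightarrow> smooth_on S g"
  using Ck_on_cong by (metis smooth_on_def)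

lemma smooth_on_const: "smooth_on S (\<lambda>x. c)"
  by (simp add: smooth_on_def Ck_on_const)

lemma smooth_on_add:
  "open S \<Longrightarrow> smooth_on S f \<Longrightarrow> smooth_on S g \<Longrightarrow> smooth_on S (\<lambda>x. f x + g x)"
  by (simp add: smooth_on_def Ck_on_add)

lemma smooth_on_bounded_linear:
  "open S \<Longrightarrow> bounded_linear L \<Longrightarrow> smooth_on S f \<Longrightarrow> smooth_on S (\<lambda>x. L (f x))"
  by (simp add: smooth_on_def Ck_on_bounded_linear)

lemma smooth_on_scaleR:
  "open S \<Longrightarrow> smooth_on S f \<Longrightarrow> smooth_on S g \<Longrightarrow> smooth_on S (\<lambda>x. f x *\<^sub>R g x)"
  by (simp add: smooth_on_def Ck_on_scaleR)

lemma smooth_on_sum: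
  "open S \<Longrightarrow> (\<And>i. i \<in> I \<Longrightarrow> smooth_on S (f i)) \<Longrightarrow> smooth_on S (\<lambda>x. \<Sum>i\<in>I. f i x)"
  by (simp add: smooth_on_def Ck_on_sum)

section \<open>Linear algebra\<close>

text \<open>A basis of \<open>S\<close> is carried to one of the image. Working with
  \<open>card\<close> of a basis keeps this valid in any real vector space, such as the function
  types of the fibres.\<close>

lemma dim_linear_image_eq:
  fixes f :: "'v::real_vector \<Rightarrow> 'w::real_vector"
  assumes "linear f" and "inj f"
  shows "dim (f ` S) = dim S"
proof -
  obtain B where B: "B \<subseteq> S" "independent B" "S \<subseteq> span B" "card B = dim S"
    using real_vector.basis_exists[of S] by auto
  have "independent (f ` B)"
    using linear_independent_injective_image[OF assms(1) B(2)] assms(2) by (meson inj_on_subset subset_UNIV)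
  moreover have "f ` S \<subseteq> span (f ` B)"
    using B(3) linear_span_image[OF assms(1)] by blast
  moreover have "f ` B \<subseteq> f ` S"
    using B(1) by blast
  ultimately have "dim (f ` S) = card (f ` B)"
    by (intro real_vector.dim_unique) auto
  also have "\<dots> = card B"
    using assms(2) by (intro card_image) (meson inj_on_subset subset_UNIV)
  finally show ?thesis
    using B(4) by simp
qed

lemma linear_on_zero: "linear_on V f \<Longrightarrow> v \<in> V \<Longrightarrow> f 0 = 0"
  unfolding linear_on_def by (metis scaleR_zero_left)

section \<open>Tangent spaces in coordinates\<close>

locale charted_manifold =
  fixes T :: "'a topology" and A :: "('a, 'e::euclidean_space) chart set"
  assumes manifold: "smooth_manifold T A"
begin

lemma chart_homeomorphic:
  "c \<in> A \<Longrightarrow> homeomorphic_map (subtopology T (fst c)) (top_of_set (chart_im c)) (snd c)"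
  using manifold by (simp add: smooth_manifold_def)

lemma open_chart_im: "c \<in> A \<Longrightarrow> open (chart_im c)"
  using manifold by (simp add: smooth_manifold_def)

lemma openin_chart_dom: "c \<in> A \<Longrightarrow> openin T (fst c)"
  using manifold by (simp add: smooth_manifold_def)

lemma smooth_transition:
  "c \<in> A \<Longrightarrow> d \<in> A \<Longrightarrow> smooth_on (snd c ` (fst c \<inter> fst d)) (transition c d)"
  using manifold by (simp add: smooth_manifold_def)

lemma inj_on_chart:
  assumes "c \<in> A"
  shows "inj_on (snd c) (fst c)"
proof -
  have "topspace (subtopology T (fst c)) = fst c"
    using openin_subset[OF openin_chart_dom[OF assms]] by (auto simp: topspace_subtopology)
  then show ?thesis
    using chart_homeomorphic[OF assms] homeomorphic_imp_injective_map by metis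
qed

lemma chart_inv_chart: "c \<in> A \<Longrightarrow> p \<in> fst c \<Longrightarrow> chart_inv c (snd c p) = p"
  by (simp add: chart_inv_def inj_on_chart)

lemma chart_inv_in: "x \<in> chart_im c \<Longrightarrow> chart_inv c x \<in> fst c"
  by (simp add: chart_inv_def chart_im_def inv_into_into)

lemma chart_inv_points: "c \<in> A \<Longrightarrow> x \<in> chart_im c \<Longrightarrow> chart_inv c x \<in> points A"
  using chart_inv_in[of x c] unfolding points_def by blast

text \<open>Makes the image of a triple overlap open, so that the chain rule for transition maps can
  be transferred there.\<close>

lemma open_chart_image:
  assumes "c \<in> A" and "openin T U" and "U \<subseteq> fst c"
  shows "open (snd c ` U)"
proof -
  have "openin (subtopology T (fst c)) U"
    using assms by (simp add: openin_open_subtopology openin_chart_dom)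
  then have "openin (top_of_set (chart_im c)) (snd c ` U)"
    using homeomorphic_imp_open_map[OF chart_homeomorphic[OF assms(1)]] by (simp add: open_map_def)
  then show ?thesis
    using open_chart_im[OF assms(1)] openin_open_eq by blast
qed

lemma transition_chart: "c \<in> A \<Longrightarrow> p \<in> fst c \<Longrightarrow> transition c d (snd c p) = snd d p"
  by (simp add: transition_def chart_inv_chart)

lemma transition_has_derivative:
  assumes "c \<in> charts_at A p" and "d \<in> charts_at A p"
  shows "(transition c d has_derivative jacobian c d p) (at (snd c p))"
proof -
  have "Ck_on (Suc 0) (snd c ` (fst c \<inter> fst d)) (transition c d)"
    using assms by (intro smooth_onD smooth_transition) (auto simp: charts_at_def)
  then show ?thesis
    unfolding jacobian_def by (rule Ck_on_Suc_has_derivative) (use assms in \<open>auto simp: charts_at_def\<close>)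
qed

lemma linear_jacobian:
  "c \<in> charts_at A p \<Longrightarrow> d \<in> charts_at A p \<Longrightarrow> linear (jacobian c d p)"
  using transition_has_derivative has_derivative_linear by blast

lemma jacobian_self:
  assumes "c \<in> charts_at A p"
  shows "jacobian c c p = (\<lambda>v. v)"
proof -
  have c: "c \<in> A" "p \<in> fst c"
    using assms by (auto simp: charts_at_def)
  have "((\<lambda>x. x) has_derivative (\<lambda>v. v)) (at (snd c p))"
    by (rule has_derivative_ident)
  then have "(transition c c has_derivative (\<lambda>v. v)) (at (snd c p))"
    by (rule has_derivative_transform_within_open[OF _ open_chart_im[OF c(1)]])
      (use c in \<open>auto simp: chart_im_def transition_chart\<close>)
  then show ?thesis
    unfolding jacobian_def using frechet_derivative_at by metis
qed

text \<open>Chain rule: on the triple overlap, passing from \<open>c\<close> to \<open>d\<close> and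
  then to \<open>e\<close> is \<open>transition c e\<close>. This cocycle rule is what makes
  \<open>coord_vec\<close> obey the transformation law.\<close>

lemma jacobian_compose:
  assumes c: "c \<in> charts_at A p" and d: "d \<in> charts_at A p" and e: "e \<in> charts_at A p"
  shows "jacobian d e p (jacobian c d p v) = jacobian c e p v"
proof -
  let ?U = "fst c \<inter> fst d \<inter> fst e"
  have A: "c \<in> A" "d \<in> A" "e \<in> A" "p \<in> ?U"
    using assms by (auto simp: charts_at_def)
  have "(transition d e has_derivative jacobian d e p) (at (transition c d (snd c p)))"
    using transition_has_derivative[OF d e] A by (simp add: transition_chart)
  then have "((\<lambda>x. transition d e (transition c d x)) has_derivative
      (\<lambda>v. jacobian d e p (jacobian c d p v))) (at (snd c p))"
    using has_derivative_compose[OF transition_has_derivative[OF c d]] by blast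
  then have "(transition c e has_derivative (\<lambda>v. jacobian d e p (jacobian c d p v))) (at (snd c p))"
  proof (rule has_derivative_transform_within_open)
    show "open (snd c ` ?U)"
      using A by (intro open_chart_image openin_Int openin_chart_dom) auto
  qed (use A in \<open>auto simp: transition_chart\<close>)
  then show ?thesis
    using has_derivative_unique[OF transition_has_derivative[OF c e]] by metis
qed

lemma tangent_spaceI:
  assumes "\<And>c. c \<notin> charts_at A p \<Longrightarrow> v c = 0"
    and "\<And>c d. c \<in> charts_at A p \<Longrightarrow> d \<in> charts_at A p \<Longrightarrow> jacobian c d p (v c) = v d"
  shows "v \<in> tangent_space A p"
  unfolding tangent_space_def
  by (intro CollectI conjI allI impI ballI) (fact assms(1), rule assms(2)[symmetric])

lemma tangent_space_off_charts: "v \<in> tangent_space A p \<Longrightarrow> c \<notin> charts_at A p \<Longrightarrow> v c = 0"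
  unfolding tangent_space_def by (drule CollectD) blast

text \<open>Oriented against the definition, so that the law serves as a rewrite rule that removes
  Jacobians.\<close>

lemma tangent_space_jacobian:
  "v \<in> tangent_space A p \<Longrightarrow> c \<in> charts_at A p \<Longrightarrow> d \<in> charts_at A p \<Longrightarrow> jacobian c d p (v c) = v d"
  unfolding tangent_space_def by (drule CollectD) (metis (no_types))

lemma zero_in_tangent_space: "0 \<in> tangent_space A p"
  by (rule tangent_spaceI) (simp_all add: linear_0 linear_jacobian)

lemma add_in_tangent_space:
  "v \<in> tangent_space A p \<Longrightarrow> w \<in> tangent_space A p \<Longrightarrow> v + w \<in> tangent_space A p"
  by (rule tangent_spaceI)
    (simp_all add: linear_add linear_jacobian tangent_space_jacobian tangent_space_off_charts)

lemma scaleR_in_tangent_space: "v \<in> tangent_space A p \<Longrightarrow> r *\<^sub>R v \<in> tangent_space A p"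
  by (rule tangent_spaceI)
    (simp_all add: linear_cmul linear_jacobian tangent_space_jacobian tangent_space_off_charts
      scaleR_fun_def)

lemma coord_vec_in_tangent_space:
  "c \<in> charts_at A p \<Longrightarrow> coord_vec A c p e \<in> tangent_space A p"
  by (rule tangent_spaceI) (simp_all add: coord_vec_def jacobian_compose)

lemma coord_vec_at_chart: "c \<in> charts_at A p \<Longrightarrow> coord_vec A c p e c = e"
  by (simp add: coord_vec_def jacobian_self)

text \<open>With \<open>coord_vec_at_chart\<close>, this makes \<open>coord_vec A c p\<close> and
  evaluation at \<open>c\<close> mutually inverse.\<close>

lemma coord_vec_of_tangent:
  "c \<in> charts_at A p \<Longrightarrow> v \<in> tangent_space A p \<Longrightarrow> coord_vec A c p (v c) = v"
  by (simp add: coord_vec_def fun_eq_iff tangent_space_jacobian tangent_space_off_charts)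

lemma linear_coord_vec:
  assumes "c \<in> charts_at A p"
  shows "linear (coord_vec A c p)"
proof (rule linearI)
  show "coord_vec A c p (x + y) = coord_vec A c p x + coord_vec A c p y" for x y
    using linear_jacobian[OF assms] by (auto simp: coord_vec_def fun_eq_iff linear_add)
  show "coord_vec A c p (r *\<^sub>R x) = r *\<^sub>R coord_vec A c p x" for r x
    using linear_jacobian[OF assms] by (auto simp: coord_vec_def fun_eq_iff linear_cmul scaleR_fun_def)
qed

lemma linear_on_coord_vec:
  assumes "c \<in> charts_at A p" and "linear_on (tangent_space A p) \<alpha>"
  shows "linear (\<lambda>e. \<alpha> (coord_vec A c p e))"
  using assms coord_vec_in_tangent_space[OF assms(1)] linear_coord_vec[OF assms(1)]
  by (intro linearI) (simp_all add: linear_add linear_cmul linear_on_def)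

lemma charts_at_chart_inv: "c \<in> A \<Longrightarrow> x \<in> chart_im c \<Longrightarrow> c \<in> charts_at A (chart_inv c x)"
  using chart_inv_in[of x c] by (simp add: charts_at_def)

lemma charts_at_nonempty: "p \<in> points A \<Longrightarrow> \<exists>c. c \<in> charts_at A p"
  by (auto simp: points_def charts_at_def)

text \<open>Covectors are total functions set to 0 off the tangent space, so agreement on it is
  equality.\<close>

lemma cotangent_eqI:
  assumes "\<alpha> \<in> cotangent_space A p" and "\<beta> \<in> cotangent_space A p"
    and "\<And>v. v \<in> tangent_space A p \<Longrightarrow> \<alpha> v = \<beta> v"
  shows "\<alpha> = \<beta>"
proof
  fix v
  show "\<alpha> v = \<beta> v"
    using assms by (cases "v \<in> tangent_space A p") (simp_all add: cotangent_space_def)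
qed

lemma uminus_in_cotangent_space: "\<alpha> \<in> cotangent_space A p \<Longrightarrow> - \<alpha> \<in> cotangent_space A p"
  by (auto simp: cotangent_space_def linear_on_def)

lemma coord_covec_in_cotangent_space: "coord_covec A c p a \<in> cotangent_space A p"
  using add_in_tangent_space scaleR_in_tangent_space
  by (auto simp: cotangent_space_def coord_covec_def linear_on_def scaleR_fun_def inner_add_right)

lemma points_charts_at: "c \<in> charts_at A p \<Longrightarrow> p \<in> points A"
  by (auto simp: charts_at_def points_def)

lemma zero_in_cotangent_space: "0 \<in> cotangent_space A p"
  by (simp add: cotangent_space_def linear_on_def)

lemma uminus_in_tangent_space: "v \<in> tangent_space A p \<Longrightarrow> - v \<in> tangent_space A p"
  using scaleR_in_tangent_space[of v p "-1"] by simp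

section \<open>Smooth vector fields and 1-forms\<close>

lemma vector_fieldsD:
  assumes "X \<in> vector_fields A"
  shows "p \<in> points A \<Longrightarrow> X p \<in> tangent_space A p" and "p \<notin> points A \<Longrightarrow> X p = 0"
    and "c \<in> A \<Longrightarrow> smooth_on (chart_im c) (\<lambda>x. X (chart_inv c x) c)"
  using assms unfolding vector_fields_def by blast+

lemma one_formsD:
  assumes "\<xi> \<in> one_forms A"
  shows "p \<in> points A \<Longrightarrow> \<xi> p \<in> cotangent_space A p" and "p \<notin> points A \<Longrightarrow> \<xi> p = 0"
    and "c \<in> A \<Longrightarrow> smooth_on (chart_im c) (\<lambda>x. \<xi> (chart_inv c x) (coord_vec A c (chart_inv c x) e))"
  using assms unfolding one_forms_def by blast+

lemma uminus_in_vector_fields: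
  assumes X: "X \<in> vector_fields A"
  shows "- X \<in> vector_fields A"
  unfolding vector_fields_def
proof (intro CollectI conjI ballI allI impI)
  fix c assume c: "c \<in> A"
  show "smooth_on (chart_im c) (\<lambda>x. (- X) (chart_inv c x) c)"
    using smooth_on_bounded_linear[OF open_chart_im[OF c] bounded_linear_minus[OF bounded_linear_ident]
        vector_fieldsD(3)[OF X c]] by simp
qed (simp_all add: vector_fieldsD[OF X] uminus_in_tangent_space)

lemma uminus_in_one_forms:
  assumes \<xi>: "\<xi> \<in> one_forms A"
  shows "- \<xi> \<in> one_forms A"
  unfolding one_forms_def
proof (intro CollectI conjI ballI allI impI)
  fix c e assume c: "c \<in> A"
  show "smooth_on (chart_im c) (\<lambda>x. (- \<xi>) (chart_inv c x) (coord_vec A c (chart_inv c x) e))"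
    using smooth_on_bounded_linear[OF open_chart_im[OF c] bounded_linear_minus[OF bounded_linear_ident]
        one_formsD(3)[OF \<xi> c]] by simp
qed (simp_all add: one_formsD[OF \<xi>] uminus_in_cotangent_space)

end

section \<open>The musical isomorphisms\<close>

text \<open>Treats both signatures at once; definiteness enters only in
  \<open>induced_metric_positive_definite_iff\<close>.\<close>

locale metric_manifold = charted_manifold T A
  for T :: "'a topology" and A :: "('a, 'e::euclidean_space) chart set" +
  fixes g :: "('a, 'e) tensor2"
  assumes metric: "metric A g"
begin

lemma metric_linear_right:
  "p \<in> points A \<Longrightarrow> v \<in> tangent_space A p \<Longrightarrow> linear_on (tangent_space A p) (g p v)"
  using metric by (auto simp: metric_def nondegenerate_symmetric_on_def bilinear_form_on_def)

lemma metric_linear_left: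
  "p \<in> points A \<Longrightarrow> w \<in> tangent_space A p \<Longrightarrow> linear_on (tangent_space A p) (\<lambda>v. g p v w)"
  using metric by (auto simp: metric_def nondegenerate_symmetric_on_def bilinear_form_on_def)

lemma metric_sym:
  "p \<in> points A \<Longrightarrow> v \<in> tangent_space A p \<Longrightarrow> w \<in> tangent_space A p \<Longrightarrow> g p v w = g p w v"
  using metric by (auto simp: metric_def nondegenerate_symmetric_on_def)

lemma metric_nondegenerate:
  "p \<in> points A \<Longrightarrow> v \<in> tangent_space A p \<Longrightarrow> (\<And>w. w \<in> tangent_space A p \<Longrightarrow> g p v w = 0) \<Longrightarrow> v = 0"
  using metric by (auto simp: metric_def nondegenerate_symmetric_on_def)

lemma metric_smooth:
  "c \<in> A \<Longrightarrow> smooth_on (chart_im c) (\<lambda>x. g (chart_inv c x) (coord_vec A c (chart_inv c x) e)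
     (coord_vec A c (chart_inv c x) e'))"
  using metric by (auto simp: metric_def Let_def)

text \<open>The matrix of \<open>g\<close> in the chart \<open>c\<close>, as an endomorphism of
  \<open>'e\<close>: covectors are identified with elements of \<open>'e\<close> by the inner
  product, so that \<open>Ck_on_linear_solve\<close> applies to it.\<close>

definition gram :: "('a, 'e) chart \<Rightarrow> 'a \<Rightarrow> 'e \<Rightarrow> 'e" where
  "gram c p e = (\<Sum>i\<in>Basis. g p (coord_vec A c p e) (coord_vec A c p i) *\<^sub>R i)"

lemma inner_gram:
  assumes c: "c \<in> charts_at A p"
  shows "gram c p e \<bullet> y = g p (coord_vec A c p e) (coord_vec A c p y)"
proof -
  have "linear (\<lambda>y. g p (coord_vec A c p e) (coord_vec A c p y))"
    using c by (intro linear_on_coord_vec metric_linear_right points_charts_at coord_vec_in_tangent_space)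
  from linear_expand[OF this, of y] show ?thesis
    by (simp add: gram_def inner_sum_left inner_commute[of y] mult.commute)
qed

lemma linear_gram:
  assumes c: "c \<in> charts_at A p"
  shows "linear (gram c p)"
proof -
  have "linear (\<lambda>e. g p (coord_vec A c p e) (coord_vec A c p y))" for y
    using linear_on_coord_vec[OF c metric_linear_left] c points_charts_at coord_vec_in_tangent_space
    by blast
  note lin = this
  show ?thesis
    by (intro linearI)
      (simp_all add: gram_def linear_add[OF lin] linear_cmul[OF lin] scaleR_add_left sum.distrib
        scaleR_sum_right)
qed

lemma inj_gram:
  assumes c: "c \<in> charts_at A p"
  shows "inj (gram c p)"
proof (subst linear_injective_0[OF linear_gram[OF c]], intro allI impI)
  fix e assume e: "gram c p e = 0"
  have "coord_vec A c p e = 0"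
  proof (rule metric_nondegenerate)
    fix w assume w: "w \<in> tangent_space A p"
    show "g p (coord_vec A c p e) w = 0"
      using inner_gram[OF c, of e "w c"] e coord_vec_of_tangent[OF c w] by simp
  qed (use c points_charts_at coord_vec_in_tangent_space in auto)
  then show "e = 0"
    using coord_vec_at_chart[OF c, of e] by simp
qed

section \<open>Flat and sharp at a point\<close>

lemma flat_at_in_cotangent_space:
  "p \<in> points A \<Longrightarrow> v \<in> tangent_space A p \<Longrightarrow> flat_at A g p v \<in> cotangent_space A p"
  using metric_linear_right[of p v] add_in_tangent_space scaleR_in_tangent_space
  by (auto simp: cotangent_space_def flat_at_def linear_on_def)

lemma flat_at_add:
  assumes "p \<in> points A" "v \<in> tangent_space A p" "w \<in> tangent_space A p"
  shows "flat_at A g p (v + w) = flat_at A g p v + flat_at A g p w"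
  using metric_linear_left[OF assms(1)] assms by (auto simp: flat_at_def linear_on_def fun_eq_iff)

lemma flat_at_scaleR:
  assumes "p \<in> points A" "v \<in> tangent_space A p"
  shows "flat_at A g p (r *\<^sub>R v) = r *\<^sub>R flat_at A g p v"
  using metric_linear_left[OF assms(1)] assms
  by (auto simp: flat_at_def linear_on_def fun_eq_iff scaleR_fun_def)

lemma inj_on_flat_at:
  assumes p: "p \<in> points A"
  shows "inj_on (flat_at A g p) (tangent_space A p)"
proof (rule inj_onI)
  fix v w assume v: "v \<in> tangent_space A p" and w: "w \<in> tangent_space A p"
    and eq: "flat_at A g p v = flat_at A g p w"
  have "v + (-1) *\<^sub>R w = 0"
  proof (rule metric_nondegenerate[OF p])
    show "v + (-1) *\<^sub>R w \<in> tangent_space A p"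
      using v w add_in_tangent_space scaleR_in_tangent_space by blast
    fix u assume u: "u \<in> tangent_space A p"
    have "flat_at A g p (v + (-1) *\<^sub>R w) u = 0"
      using flat_at_add[OF p v scaleR_in_tangent_space[OF w, of "-1"]] flat_at_scaleR[OF p w, of "-1"] eq
      by (simp add: scaleR_fun_def)
    then show "g p (v + (-1) *\<^sub>R w) u = 0"
      using u by (simp add: flat_at_def)
  qed
  then show "v = w"
    by simp
qed

text \<open>The dimension count happens on \<open>'e\<close>, where the injective
  \<open>gram c p\<close> is onto: solving for the components of \<alpha> gives the coordinates
  \<open>y\<close> of a preimage.\<close>

lemma flat_at_surj:
  assumes p: "p \<in> points A" and \<alpha>: "\<alpha> \<in> cotangent_space A p"
  shows "\<alpha> \<in> flat_at A g p ` tangent_space A p"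
proof -
  obtain c where c: "c \<in> charts_at A p"
    using charts_at_nonempty[OF p] by blast
  obtain y where y: "gram c p y = (\<Sum>i\<in>Basis. \<alpha> (coord_vec A c p i) *\<^sub>R i)"
    using linear_injective_imp_surjective[OF linear_gram[OF c] inj_gram[OF c]] by (metis surjD)
  have V: "coord_vec A c p y \<in> tangent_space A p"
    using c by (rule coord_vec_in_tangent_space)
  have "\<alpha> = flat_at A g p (coord_vec A c p y)"
  proof (rule cotangent_eqI[OF \<alpha> flat_at_in_cotangent_space[OF p V]])
    fix v assume v: "v \<in> tangent_space A p"
    have "linear (\<lambda>e. \<alpha> (coord_vec A c p e))"
      using \<alpha> by (intro linear_on_coord_vec[OF c]) (simp add: cotangent_space_def)
    from linear_expand[OF this, of "v c"]
    have "\<alpha> v = gram c p y \<bullet> v c"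
      by (simp add: coord_vec_of_tangent[OF c v] y inner_sum_left inner_commute[of "v c"] mult.commute)
    then show "\<alpha> v = flat_at A g p (coord_vec A c p y) v"
      using v by (simp add: inner_gram[OF c] coord_vec_of_tangent[OF c v] flat_at_def)
  qed
  then show ?thesis
    using V by blast
qed

lemma sharp_at_in_tangent_space:
  "p \<in> points A \<Longrightarrow> \<alpha> \<in> cotangent_space A p \<Longrightarrow> sharp_at A g p \<alpha> \<in> tangent_space A p"
  unfolding sharp_at_def by (intro inv_into_into flat_at_surj)

lemma flat_at_sharp_at:
  "p \<in> points A \<Longrightarrow> \<alpha> \<in> cotangent_space A p \<Longrightarrow> flat_at A g p (sharp_at A g p \<alpha>) = \<alpha>"
  unfolding sharp_at_def using flat_at_surj by (simp add: f_inv_into_f)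

lemma sharp_at_flat_at:
  "p \<in> points A \<Longrightarrow> v \<in> tangent_space A p \<Longrightarrow> sharp_at A g p (flat_at A g p v) = v"
  unfolding sharp_at_def by (intro inv_into_f_f inj_on_flat_at)

lemma metric_sharp_at:
  assumes "p \<in> points A" "\<alpha> \<in> cotangent_space A p" "w \<in> tangent_space A p"
  shows "g p (sharp_at A g p \<alpha>) w = \<alpha> w"
  using fun_cong[OF flat_at_sharp_at[OF assms(1,2)], of w] assms(3) by (simp add: flat_at_def)

lemma sharp_at_add:
  assumes "p \<in> points A" "\<alpha> \<in> cotangent_space A p" "\<beta> \<in> cotangent_space A p"
  shows "sharp_at A g p (\<alpha> + \<beta>) = sharp_at A g p \<alpha> + sharp_at A g p \<beta>"
proof -
  have "\<alpha> + \<beta> = flat_at A g p (sharp_at A g p \<alpha> + sharp_at A g p \<beta>)"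
    using assms by (simp add: flat_at_add sharp_at_in_tangent_space flat_at_sharp_at)
  then show ?thesis
    using assms by (simp add: sharp_at_flat_at add_in_tangent_space sharp_at_in_tangent_space)
qed

lemma sharp_at_scaleR:
  assumes "p \<in> points A" "\<alpha> \<in> cotangent_space A p"
  shows "sharp_at A g p (r *\<^sub>R \<alpha>) = r *\<^sub>R sharp_at A g p \<alpha>"
proof -
  have "r *\<^sub>R \<alpha> = flat_at A g p (r *\<^sub>R sharp_at A g p \<alpha>)"
    using assms by (simp add: flat_at_scaleR sharp_at_in_tangent_space flat_at_sharp_at)
  then show ?thesis
    using assms by (simp add: sharp_at_flat_at scaleR_in_tangent_space sharp_at_in_tangent_space)
qed

text \<open>Stated for covector fields given on a single chart domain, so that it covers 1-forms as
  well as the coordinate covectors in the smoothness clause of \<open>gen_metric\<close>.\<close>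

lemma smooth_sharp_at:
  assumes c: "c \<in> A" and \<alpha>: "\<And>p. p \<in> fst c \<Longrightarrow> \<alpha> p \<in> cotangent_space A p"
    and smooth: "\<And>e. smooth_on (chart_im c) (\<lambda>x. \<alpha> (chart_inv c x) (coord_vec A c (chart_inv c x) e))"
  shows "smooth_on (chart_im c) (\<lambda>x. sharp_at A g (chart_inv c x) (\<alpha> (chart_inv c x)) c)"
proof (rule smooth_onI, rule Ck_on_linear_solve[where M = "\<lambda>x. gram c (chart_inv c x)"])
  show "Ck_on k (chart_im c) (\<lambda>x. gram c (chart_inv c x) e)" for k e
    unfolding gram_def
    by (intro smooth_onD smooth_on_sum smooth_on_scaleR smooth_on_const open_chart_im metric_smooth c)
  show "Ck_on k (chart_im c)
      (\<lambda>x. \<Sum>i\<in>Basis. \<alpha> (chart_inv c x) (coord_vec A c (chart_inv c x) i) *\<^sub>R i)" for k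
    by (intro smooth_onD smooth_on_sum smooth_on_scaleR smooth_on_const open_chart_im smooth c)
  fix x assume x: "x \<in> chart_im c"
  let ?p = "chart_inv c x"
  have cp: "c \<in> charts_at A ?p"
    by (rule charts_at_chart_inv[OF c x])
  show "linear (gram c ?p)" "inj (gram c ?p)"
    using cp by (rule linear_gram, rule inj_gram)
  have p: "?p \<in> points A" and \<alpha>p: "\<alpha> ?p \<in> cotangent_space A ?p"
    using chart_inv_points[OF c x] \<alpha> chart_inv_in[OF x] by auto
  \<comment> \<open>The component along \<open>i\<close> says that pairing the sharp of \<alpha>
    with the coordinate vector of \<open>i\<close> under \<open>g\<close> gives \<alpha> of that
    vector.\<close>
  show "gram c ?p (sharp_at A g ?p (\<alpha> ?p) c) = (\<Sum>i\<in>Basis. \<alpha> ?p (coord_vec A c ?p i) *\<^sub>R i)"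
    by (simp add: gram_def coord_vec_of_tangent[OF cp] sharp_at_in_tangent_space[OF p \<alpha>p]
        metric_sharp_at[OF p \<alpha>p] coord_vec_in_tangent_space[OF cp])
qed (use open_chart_im c in auto)

lemma metric_sharp_at_right:
  assumes "p \<in> points A" "\<alpha> \<in> cotangent_space A p" "v \<in> tangent_space A p"
  shows "g p v (sharp_at A g p \<alpha>) = \<alpha> v"
  using metric_sharp_at[OF assms] metric_sym[OF assms(1,3) sharp_at_in_tangent_space[OF assms(1,2)]] by simp

lemma sharp_at_zero: "p \<in> points A \<Longrightarrow> sharp_at A g p 0 = 0"
  using sharp_at_scaleR[of p 0 0] zero_in_cotangent_space by simp

lemma metric_uminus:
  assumes p: "p \<in> points A" and v: "v \<in> tangent_space A p" and w: "w \<in> tangent_space A p"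
  shows "g p (- v) w = - g p v w" and "g p v (- w) = - g p v w"
proof -
  have "g p ((-1) *\<^sub>R v) w = (-1) *\<^sub>R g p v w"
    using metric_linear_left[OF p w] v unfolding linear_on_def by blast
  then show "g p (- v) w = - g p v w"
    by simp
  have "g p v ((-1) *\<^sub>R w) = (-1) *\<^sub>R g p v w"
    using metric_linear_right[OF p v] w unfolding linear_on_def by blast
  then show "g p v (- w) = - g p v w"
    by simp
qed

section \<open>Flat and sharp on smooth sections\<close>

lemma flat_in_one_forms:
  assumes X: "X \<in> vector_fields A"
  shows "flat A g X \<in> one_forms A"
  unfolding one_forms_def
proof (intro CollectI conjI ballI allI impI)
  fix p assume "p \<in> points A"
  then show "flat A g X p \<in> cotangent_space A p"
    by (simp add: flat_def flat_at_in_cotangent_space vector_fieldsD[OF X])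
next
  fix p assume "p \<notin> points A"
  then show "flat A g X p = 0"
    by (simp add: flat_def)
next
  fix c e assume c: "c \<in> A"
  let ?cv = "\<lambda>x. coord_vec A c (chart_inv c x)"
  \<comment> \<open>Lowering an index in coordinates: the components of \<open>X\<close> are
    contracted with those of \<open>g\<close>.\<close>
  have "smooth_on (chart_im c)
      (\<lambda>x. \<Sum>i\<in>Basis. (X (chart_inv c x) c \<bullet> i) *\<^sub>R g (chart_inv c x) (?cv x i) (?cv x e))"
    by (intro smooth_on_sum smooth_on_scaleR metric_smooth open_chart_im c vector_fieldsD[OF X]
        smooth_on_bounded_linear[OF _ bounded_linear_inner_left])
  then show "smooth_on (chart_im c) (\<lambda>x. flat A g X (chart_inv c x) (?cv x e))"
  proof (rule smooth_on_cong[OF open_chart_im[OF c], rotated])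
    fix x assume x: "x \<in> chart_im c"
    let ?p = "chart_inv c x"
    have cp: "c \<in> charts_at A ?p"
      by (rule charts_at_chart_inv[OF c x])
    have p: "?p \<in> points A"
      by (rule chart_inv_points[OF c x])
    have lin: "linear (\<lambda>v. g ?p (?cv x v) (?cv x e))"
      using linear_on_coord_vec[OF cp metric_linear_left[OF p coord_vec_in_tangent_space[OF cp]]] .
    show "(\<Sum>i\<in>Basis. (X ?p c \<bullet> i) *\<^sub>R g ?p (?cv x i) (?cv x e)) = flat A g X ?p (?cv x e)"
      using p linear_expand[OF lin, of "X ?p c"]
      by (simp add: flat_def flat_at_def coord_vec_in_tangent_space[OF cp]
          coord_vec_of_tangent[OF cp] vector_fieldsD(1)[OF X p])
  qed
qed

lemma sharp_in_vector_fields: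
  assumes \<xi>: "\<xi> \<in> one_forms A"
  shows "sharp A g \<xi> \<in> vector_fields A"
  unfolding vector_fields_def
proof (intro CollectI conjI ballI allI impI)
  fix p assume "p \<in> points A"
  then show "sharp A g \<xi> p \<in> tangent_space A p"
    by (simp add: sharp_def sharp_at_in_tangent_space one_formsD[OF \<xi>])
next
  fix p assume "p \<notin> points A"
  then show "sharp A g \<xi> p = 0"
    by (simp add: sharp_def)
next
  fix c assume c: "c \<in> A"
  have "smooth_on (chart_im c) (\<lambda>x. sharp_at A g (chart_inv c x) (\<xi> (chart_inv c x)) c)"
    using c by (intro smooth_sharp_at one_formsD[OF \<xi>]) (auto simp: points_def)
  then show "smooth_on (chart_im c) (\<lambda>x. sharp A g \<xi> (chart_inv c x) c)"
    by (rule smooth_on_cong[OF open_chart_im[OF c], rotated]) (simp add: sharp_def chart_inv_points c)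
qed

text \<open>An equality of total functions: off \<open>points A\<close> both sides are 0 by
  convention.\<close>

lemma flat_sharp: "\<xi> \<in> one_forms A \<Longrightarrow> flat A g (sharp A g \<xi>) = \<xi>"
  by (rule ext) (simp add: flat_def sharp_def flat_at_sharp_at one_formsD zero_fun_def)

lemma sharp_flat: "X \<in> vector_fields A \<Longrightarrow> sharp A g (flat A g X) = X"
  by (rule ext) (simp add: flat_def sharp_def sharp_at_flat_at vector_fieldsD zero_fun_def)

lemma flat_add:
  "X \<in> vector_fields A \<Longrightarrow> Y \<in> vector_fields A \<Longrightarrow> flat A g (X + Y) = flat A g X + flat A g Y"
  by (rule ext) (simp add: flat_def flat_at_add vector_fieldsD)

lemma sharp_add:
  "\<xi> \<in> one_forms A \<Longrightarrow> \<eta> \<in> one_forms A \<Longrightarrow> sharp A g (\<xi> + \<eta>) = sharp A g \<xi> + sharp A g \<eta>"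
  by (rule ext) (simp add: sharp_def sharp_at_add one_formsD)

text \<open>The function \<open>f\<close> is arbitrary because scaling acts pointwise. The constant
  -1, which need not lie in \<open>smooth_functions A\<close>, can thus be inserted to obtain
  \<open>flat_uminus\<close>.\<close>

lemma flat_smul:
  "X \<in> vector_fields A \<Longrightarrow> flat A g (\<lambda>p. f p *\<^sub>R X p) = (\<lambda>p. f p *\<^sub>R flat A g X p)"
  by (rule ext) (simp add: flat_def flat_at_scaleR vector_fieldsD)

lemma sharp_smul:
  "\<xi> \<in> one_forms A \<Longrightarrow> sharp A g (\<lambda>p. f p *\<^sub>R \<xi> p) = (\<lambda>p. f p *\<^sub>R sharp A g \<xi> p)"
  by (rule ext) (simp add: sharp_def sharp_at_scaleR one_formsD)

lemma flat_uminus: "X \<in> vector_fields A \<Longrightarrow> flat A g (- X) = - flat A g X"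
  using flat_smul[of X "\<lambda>_. -1"] by (simp add: fun_Compl_def)

lemma sharp_uminus: "\<xi> \<in> one_forms A \<Longrightarrow> sharp A g (- \<xi>) = - sharp A g \<xi>"
  using sharp_smul[of \<xi> "\<lambda>_. -1"] by (simp add: fun_Compl_def)

section \<open>The induced generalized structures\<close>

lemma J_of_pair: "J_of A g (X, \<xi>) = (- sharp A g \<xi>, flat A g X)"
  by (simp add: J_of_def block_matrix_def)

lemma F_of_pair: "F_of A g (X, \<xi>) = (sharp A g \<xi>, flat A g X)"
  by (simp add: F_of_def block_matrix_def)

lemma gen_almost_complex_J: "gen_almost_complex A (J_of A g)"
  unfolding gen_almost_complex_def gen_endomorphism_def gen_sections_def
  by (auto simp: J_of_pair smul_sec_def flat_in_one_forms sharp_in_vector_fields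
      uminus_in_vector_fields flat_add sharp_add flat_smul sharp_smul sharp_flat flat_sharp flat_uminus
      fun_eq_iff)

lemma gen_almost_product_F: "gen_almost_product A (F_of A g)"
  unfolding gen_almost_product_def gen_endomorphism_def gen_sections_def
  by (auto simp: F_of_pair smul_sec_def flat_in_one_forms sharp_in_vector_fields
      flat_add sharp_add flat_smul sharp_smul sharp_flat flat_sharp)

text \<open>The conjugation \<open>X + \<xi> \<mapsto> X - \<xi>\<close> anticommutes with \<open>F_of A g\<close>, hence swaps its eigenbundles.\<close>
lemma eigenbundle_F_conjugate:
  "(\<lambda>(v, \<alpha>). (v, - \<alpha>)) ` eigenbundle_at A (F_of A g) s p \<subseteq> eigenbundle_at A (F_of A g) (- s) p"
proof clarify
  fix v \<alpha> assume "(v, \<alpha>) \<in> eigenbundle_at A (F_of A g) s p"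
  then obtain X \<xi> where X: "X \<in> vector_fields A" and \<xi>: "\<xi> \<in> one_forms A"
    and F: "F_of A g (X, \<xi>) = s *\<^sub>R (X, \<xi>)" and p: "v = X p" "\<alpha> = \<xi> p"
    by (auto simp: eigenbundle_at_def gen_sections_def sec_at_def)
  \<comment> \<open>Negating \<xi> negates the vector part of the image and keeps its form part,
    which turns the eigenvalue \<open>s\<close> into \<open>- s\<close>.\<close>
  have "F_of A g (X, - \<xi>) = (- s) *\<^sub>R (X, - \<xi>)"
    using F by (simp add: F_of_pair sharp_uminus[OF \<xi>])
  moreover have "(X, - \<xi>) \<in> gen_sections A"
    using X uminus_in_one_forms[OF \<xi>] by (simp add: gen_sections_def)
  moreover have "(v, - \<alpha>) = sec_at (X, - \<xi>) p"
    by (simp add: sec_at_def p)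
  ultimately show "(v, - \<alpha>) \<in> eigenbundle_at A (F_of A g) (- s) p"
    unfolding eigenbundle_at_def by blast
qed

text \<open>Fibres consist of values of global eigensections, so computing their dimension would
  require extending vectors at a point to sections. Comparing the two fibres avoids this, since the
  conjugation already acts on sections.\<close>

lemma gen_almost_paracomplex_F: "gen_almost_paracomplex A (F_of A g)"
  unfolding gen_almost_paracomplex_def
proof (intro conjI ballI gen_almost_product_F)
  fix p
  let ?f = "\<lambda>(v, \<alpha>). (v, - \<alpha>) :: ('a, 'e) gvec"
  let ?E = "\<lambda>s. eigenbundle_at A (F_of A g) s p"
  have "linear ?f"
    by (rule linearI) auto
  moreover have "inj ?f"
    by (auto simp: inj_def)
  moreover have "?f ` ?E 1 = ?E (-1)"
  proof
    show "?f ` ?E 1 \<subseteq> ?E (-1)"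
      by (rule eigenbundle_F_conjugate)
    \<comment> \<open>The conjugation is an involution, so its image of the inclusion for eigenvalue
      -1 is the reverse inclusion.\<close>
    have "?f ` ?f ` ?E (-1) \<subseteq> ?f ` ?E 1"
      using eigenbundle_F_conjugate[of "-1" p] by (intro image_mono) simp
    moreover have "?f ` ?f ` ?E (-1) = ?E (-1)"
      by (simp add: image_image case_prod_unfold)
    ultimately show "?E (-1) \<subseteq> ?f ` ?E 1"
      by simp
  qed
  ultimately show "dim (?E 1) = dim (?E (-1))"
    using dim_linear_image_eq by metis
qed

section \<open>The induced generalized metric\<close>

lemma induced_metric_pair:
  "induced_metric A g p (v, \<alpha>) (w, \<beta>) = g p v w + g p (sharp_at A g p \<alpha>) (sharp_at A g p \<beta>)"
  by (simp add: induced_metric_def)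

text \<open>Testing \<open>(v, \<alpha>)\<close> against \<open>(w, 0)\<close> isolates
  \<open>v\<close>; testing it against \<open>(0, flat_at A g p w)\<close> isolates the sharp of
  \<alpha>.\<close>

lemma induced_metric_nondegenerate:
  assumes p: "p \<in> points A"
  shows "nondegenerate_symmetric_on (gen_space A p) (induced_metric A g p)"
  unfolding nondegenerate_symmetric_on_def bilinear_form_on_def
proof (intro conjI ballI impI)
  note right = metric_linear_right[OF p, unfolded linear_on_def]
  note left = metric_linear_left[OF p, unfolded linear_on_def]
  note sharp = sharp_at_in_tangent_space[OF p] sharp_at_add[OF p] sharp_at_scaleR[OF p]
  fix u assume "u \<in> gen_space A p"
  then obtain v \<alpha> where u: "u = (v, \<alpha>)" and v: "v \<in> tangent_space A p" and \<alpha>: "\<alpha> \<in> cotangent_space A p"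
    by (auto simp: gen_space_def)
  show "linear_on (gen_space A p) (induced_metric A g p u)"
    using v \<alpha> by (auto simp: linear_on_def gen_space_def u induced_metric_pair right sharp algebra_simps)
  show "linear_on (gen_space A p) (\<lambda>w. induced_metric A g p w u)"
    using v \<alpha> by (auto simp: linear_on_def gen_space_def u induced_metric_pair left sharp algebra_simps)
  show "induced_metric A g p u w = induced_metric A g p w u" if "w \<in> gen_space A p" for w
    using that v \<alpha> metric_sym[OF p] by (auto simp: gen_space_def u induced_metric_pair sharp)
  assume zero: "\<forall>w\<in>gen_space A p. induced_metric A g p u w = 0"
  have z: "induced_metric A g p (v, \<alpha>) (w, \<beta>) = 0"
    if "w \<in> tangent_space A p" "\<beta> \<in> cotangent_space A p" for w \<beta>
    using zero that by (auto simp: gen_space_def u)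
  have "v = 0"
  proof (rule metric_nondegenerate[OF p v])
    fix w assume "w \<in> tangent_space A p"
    then show "g p v w = 0"
      using z[OF _ zero_in_cotangent_space, of w]
        linear_on_zero[OF metric_linear_right[OF p sharp(1)[OF \<alpha>]] v]
      by (simp add: induced_metric_pair sharp_at_zero[OF p])
  qed
  moreover have "sharp_at A g p \<alpha> = 0"
  proof (rule metric_nondegenerate[OF p sharp(1)[OF \<alpha>]])
    fix w assume w: "w \<in> tangent_space A p"
    then show "g p (sharp_at A g p \<alpha>) w = 0"
      using z[OF zero_in_tangent_space flat_at_in_cotangent_space[OF p w]]
        linear_on_zero[OF metric_linear_right[OF p v] v]
      by (simp add: induced_metric_pair sharp_at_flat_at[OF p])
  qed
  \<comment> \<open>Scaling by 0 shows that the flat of 0 is 0.\<close>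
  then have "\<alpha> = 0"
    using flat_at_sharp_at[OF p \<alpha>] flat_at_scaleR[OF p v, of 0] by simp
  ultimately show "u = 0"
    by (simp add: u zero_prod_def)
qed

text \<open>Only one sharp has to be differentiated: pairing the sharps of \<alpha> and \<beta>
  under \<open>g\<close> gives \<alpha> of the sharp of \<beta>, which for a coordinate covector is
  an inner product with the constant \<open>a\<close>.\<close>

lemma gen_metric_induced: "gen_metric A (induced_metric A g)"
  unfolding gen_metric_def Let_def
proof (intro conjI ballI allI induced_metric_nondegenerate)
  fix c e a e' a' assume c: "c \<in> A"
  let ?cv = "\<lambda>x. coord_vec A c (chart_inv c x)"
  let ?cc = "\<lambda>x. coord_covec A c (chart_inv c x)"
  have "smooth_on (chart_im c) (\<lambda>x. coord_covec A c (chart_inv c x) a' (?cv x b))" for b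
  proof (rule smooth_on_cong[OF open_chart_im[OF c] _ smooth_on_const])
    show "a' \<bullet> b = ?cc x a' (?cv x b)" if "x \<in> chart_im c" for x
      using charts_at_chart_inv[OF c that]
      by (simp add: coord_covec_def coord_vec_in_tangent_space coord_vec_at_chart)
  qed
  then have "smooth_on (chart_im c) (\<lambda>x. sharp_at A g (chart_inv c x) (?cc x a') c)"
    by (rule smooth_sharp_at[OF c coord_covec_in_cotangent_space])
  then have "smooth_on (chart_im c) (\<lambda>x. g (chart_inv c x) (?cv x e) (?cv x e')
      + a \<bullet> sharp_at A g (chart_inv c x) (?cc x a') c)"
    by (intro smooth_on_add metric_smooth open_chart_im c
        smooth_on_bounded_linear[OF _ bounded_linear_inner_right])
  then show "smooth_on (chart_im c) (\<lambda>x. induced_metric A g (chart_inv c x)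
      (?cv x e, ?cc x a) (?cv x e', ?cc x a'))"
  proof (rule smooth_on_cong[OF open_chart_im[OF c], rotated])
    fix x assume x: "x \<in> chart_im c"
    let ?p = "chart_inv c x"
    have p: "?p \<in> points A"
      by (rule chart_inv_points[OF c x])
    show "g ?p (?cv x e) (?cv x e') + a \<bullet> sharp_at A g ?p (?cc x a') c
        = induced_metric A g ?p (?cv x e, ?cc x a) (?cv x e', ?cc x a')"
      using sharp_at_in_tangent_space[OF p coord_covec_in_cotangent_space, of c a']
        metric_sharp_at[OF p coord_covec_in_cotangent_space, of _ c a]
      \<comment> \<open>The first call contracts the two sharps to one; only then is the remaining
        covector unfolded.\<close>
      by (simp add: induced_metric_pair) (simp add: coord_covec_def[of A c ?p a])
  qed
qed

text \<open>Forwards, restrict to pairs \<open>(v, 0)\<close>; backwards, both summands are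
  nonnegative and one is positive because sharp is injective. The pseudo-Riemannian case is a
  failure of definiteness and uses the forward direction.\<close>

lemma induced_metric_positive_definite_iff:
  assumes p: "p \<in> points A"
  shows "positive_definite_on (gen_space A p) (induced_metric A g p)
    \<longleftrightarrow> positive_definite_on (tangent_space A p) (g p)"
proof
  assume G: "positive_definite_on (gen_space A p) (induced_metric A g p)"
  show "positive_definite_on (tangent_space A p) (g p)"
    unfolding positive_definite_on_def
  proof (intro ballI impI)
    fix v assume v: "v \<in> tangent_space A p" "v \<noteq> 0"
    then have "induced_metric A g p (v, 0) (v, 0) > 0"
      using G zero_in_cotangent_space
      by (auto simp: positive_definite_on_def gen_space_def zero_prod_def)
    then show "g p v v > 0"
      using linear_on_zero[OF metric_linear_right[OF p zero_in_tangent_space] v(1)]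
      by (simp add: induced_metric_pair sharp_at_zero[OF p])
  qed
next
  assume g: "positive_definite_on (tangent_space A p) (g p)"
  have nonneg: "g p v v \<ge> 0" if "v \<in> tangent_space A p" for v
    using g that linear_on_zero[OF metric_linear_right[OF p that] that]
    by (cases "v = 0") (auto simp: positive_definite_on_def less_imp_le)
  show "positive_definite_on (gen_space A p) (induced_metric A g p)"
    unfolding positive_definite_on_def
  proof (intro ballI impI)
    fix u assume "u \<in> gen_space A p" "u \<noteq> 0"
    then obtain v \<alpha> where u: "u = (v, \<alpha>)" and v: "v \<in> tangent_space A p"
      and \<alpha>: "\<alpha> \<in> cotangent_space A p" and nz: "v \<noteq> 0 \<or> \<alpha> \<noteq> 0"
      by (auto simp: gen_space_def zero_prod_def)
    have S: "sharp_at A g p \<alpha> \<in> tangent_space A p"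
      by (rule sharp_at_in_tangent_space[OF p \<alpha>])
    have "sharp_at A g p \<alpha> \<noteq> 0" if "\<alpha> \<noteq> 0"
      using that flat_at_sharp_at[OF p \<alpha>] flat_at_scaleR[OF p v, of 0] by auto
    then have "g p v v > 0 \<or> g p (sharp_at A g p \<alpha>) (sharp_at A g p \<alpha>) > 0"
      using nz g v S by (auto simp: positive_definite_on_def)
    then show "induced_metric A g p u u > 0"
      using nonneg[OF v] nonneg[OF S] by (auto simp: u induced_metric_pair)
  qed
qed

section \<open>Isometry and fundamental tensors\<close>

lemma sharp_apply: "p \<in> points A \<Longrightarrow> sharp A g \<xi> p = sharp_at A g p (\<xi> p)"
  by (simp add: sharp_def)

lemma flat_apply: "p \<in> points A \<Longrightarrow> flat A g X p = flat_at A g p (X p)"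
  by (simp add: flat_def)

text \<open>\<open>J_of A g\<close> exchanges the two summands of the metric: the flats are undone
  by the sharps inside it, and the two minus signs cancel.\<close>

lemma isometric_J: "isometric A (J_of A g) (induced_metric A g)"
  unfolding isometric_def gen_sections_def
  by (auto simp: apply_tensor_def sec_at_def J_of_pair sharp_apply flat_apply induced_metric_pair
      sharp_at_flat_at vector_fieldsD one_formsD metric_uminus sharp_at_in_tangent_space
      uminus_in_tangent_space)

lemma isometric_F: "isometric A (F_of A g) (induced_metric A g)"
  unfolding isometric_def gen_sections_def
  by (auto simp: apply_tensor_def sec_at_def F_of_pair sharp_apply flat_apply induced_metric_pair
      sharp_at_flat_at vector_fieldsD)

text \<open>The summands become minus \<xi> of \<open>Y\<close> and, by symmetry of
  \<open>g\<close>, \<eta> of \<open>X\<close>; the factor 2 undoes the half in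
  \<open>Omega0\<close>.\<close>

lemma fundamental_tensor_J:
  assumes "X \<in> vector_fields A" "Y \<in> vector_fields A" "\<xi> \<in> one_forms A" "\<eta> \<in> one_forms A" "p \<in> points A"
  shows "fundamental_tensor (J_of A g) (induced_metric A g) (X, \<xi>) (Y, \<eta>) p
    = - 2 * Omega0 (X, \<xi>) (Y, \<eta>) p"
  using assms
  by (simp add: fundamental_tensor_def apply_tensor_def sec_at_def J_of_pair Omega0_def sharp_apply
      flat_apply induced_metric_pair sharp_at_flat_at vector_fieldsD one_formsD metric_uminus
      sharp_at_in_tangent_space metric_sharp_at metric_sharp_at_right)

lemma fundamental_tensor_F:
  assumes "X \<in> vector_fields A" "Y \<in> vector_fields A" "\<xi> \<in> one_forms A" "\<eta> \<in> one_forms A" "p \<in> points A"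
  shows "fundamental_tensor (F_of A g) (induced_metric A g) (X, \<xi>) (Y, \<eta>) p
    = 2 * G0 (X, \<xi>) (Y, \<eta>) p"
  using assms
  by (simp add: fundamental_tensor_def apply_tensor_def sec_at_def F_of_pair G0_def sharp_apply
      flat_apply induced_metric_pair sharp_at_flat_at vector_fieldsD one_formsD
      metric_sharp_at metric_sharp_at_right)

end

theorem proposition4p14:
  fixes T :: "'a topology"
    and A :: "('a, 'e::euclidean_space) chart set"
    and g :: "('a, 'e) tensor2"
  assumes "smooth_manifold T A"
    and "riemannian A g \<or> pseudo_riemannian A g"
  shows "gen_almost_complex A (J_of A g) \<and> gen_almost_paracomplex A (F_of A g) \<and>
    gen_metric A (induced_metric A g) \<and>
    isometric A (J_of A g) (induced_metric A g) \<and>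
    isometric A (F_of A g) (induced_metric A g) \<and>
    (riemannian A g \<longrightarrow>
       gen_almost_hermitian A (J_of A g) (induced_metric A g) \<and>
       gen_almost_para_norden A (F_of A g) (induced_metric A g)) \<and>
    (pseudo_riemannian A g \<longrightarrow>
       gen_indefinite_almost_hermitian A (J_of A g) (induced_metric A g) \<and>
       gen_pseudo_riemannian_almost_product A (F_of A g) (induced_metric A g)) \<and>
    (\<forall>X\<in>vector_fields A. \<forall>Y\<in>vector_fields A. \<forall>\<xi>\<in>one_forms A. \<forall>\<eta>\<in>one_forms A. \<forall>p\<in>points A.
       fundamental_tensor (J_of A g) (induced_metric A g) (X, \<xi>) (Y, \<eta>) p
         = - 2 * Omega0 (X, \<xi>) (Y, \<eta>) p \<and>
       fundamental_tensor (F_of A g) (induced_metric A g) (X, \<xi>) (Y, \<eta>) p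
         = 2 * G0 (X, \<xi>) (Y, \<eta>) p)"
proof -
  interpret metric_manifold T A g
    using assms by unfold_locales (auto simp: riemannian_def pseudo_riemannian_def)
  have riem: "gen_riemannian A (induced_metric A g)" if "riemannian A g"
    using that gen_metric_induced induced_metric_positive_definite_iff
    by (simp add: gen_riemannian_def riemannian_def)
  have pseudo: "gen_pseudo_riemannian A (induced_metric A g)" if "pseudo_riemannian A g"
    using that gen_metric_induced induced_metric_positive_definite_iff
    by (simp add: gen_pseudo_riemannian_def pseudo_riemannian_def)
  show ?thesis
    using riem pseudo gen_almost_complex_J gen_almost_paracomplex_F gen_almost_product_F
      gen_metric_induced isometric_J isometric_F fundamental_tensor_J fundamental_tensor_F
    by (simp add: gen_almost_hermitian_def gen_almost_para_norden_def
        gen_indefinite_almost_hermitian_def gen_pseudo_riemannian_almost_product_def)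
qed

end
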